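(* Let $\alpha\ge-\frac12$, $1\le p<\infty$, and let $K\subset L_{p,\alpha}$ be bounded. Then $K$ is precompact (totally bounded) in $L_{p,\alpha}$ if and only if the following two conditions are fulfilled. $(\mathbf{P_A})$ $K$ is equivanishing: for every $\varepsilon>0$ there is an $R>0$ such that for all $f\in K$ $$\left(\int_R^\infty|f(x)|^px^{2\alpha+1}\,dx\right)^{\frac1p}<\varepsilon .$$ $(\mathbf{P_B})$ $K$ is $L_{p,\alpha}$-equicontinuous: for every $\varepsilon>0$ and every $M_0>0$ there is a $\delta>0$ such that for all $0\le h\le\delta$, all $f\in K$ and all $t\in[0,M_0]$ $$\left(\int_0^\infty|T_{t+h,\alpha}f(s)-T_{t,\alpha}f(s)|^ps^{2\alpha+1}\,ds\right)^{\frac1p}<\varepsilon .$$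
   Context: For $\alpha\ge-\frac12$ and $1\le p<\infty$, $L_{p,\alpha}$ is the space of measurable (real- or complex-valued) functions on $\mathbb{R}_+$ with finite norm $\|f\|_{p,(\alpha)}=\left(\int_0^\infty|f(x)|^px^{2\alpha+1}dx\right)^{1/p}$. The Bessel translation is, for $t,s\ge0$, $$T_{t,\alpha}f(s)=\int_0^\pi f\left(\sqrt{t^2+s^2-2st\cos\varphi}\right)d\mu(\varphi),\qquad d\mu(\varphi)=c_\alpha\sin^{2\alpha}\varphi\,d\varphi,\quad c_\alpha=\left(\int_0^\pi\sin^{2\alpha}\varphi\,d\varphi\right)^{-1}.$$ For $\alpha=-\frac12$ the probability measure $\mu$ is understood as its weak limit $\frac12(\delta_0+\delta_\pi)$, i.e. $T_{t,-1/2}f(s)=\frac12\left(f(s+t)+f(|s-t|)\right)$. *)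

theory Defs
  imports "HOL-Analysis.Analysis"
begin

definition bessel_measure :: "real \<Rightarrow> real measure" where
  "bessel_measure \<alpha> = density (lebesgue_on {0..}) (\<lambda>x. ennreal (x powr (2 * \<alpha> + 1)))"

text \<open>
  \<open>(\<integral> |f|\<^sup>p dM)\<^sup>1\<^sup>/\<^sup>p\<close> as an extended nonnegative number; the case distinction is needed because
  \<open>powr\<close> is not available on \<^typ>\<open>ennreal\<close>.
\<close>

definition eLp_norm :: "real \<Rightarrow> 'b measure \<Rightarrow> ('b \<Rightarrow> 'a::real_normed_vector) \<Rightarrow> ennreal" where
  "eLp_norm p M f =
     (let I = (\<integral>\<^sup>+x. ennreal (norm (f x) powr p) \<partial>M)
      in if I = \<infinity> then \<infinity> else ennreal (enn2real I powr (1 / p)))"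

text \<open>
  Elements of \<open>Lp\<close> are Lebesgue measurable functions, not equivalence classes, so
  \<open>eLp_norm\<close> is only a seminorm on it. The values of a function on the negative half-line
  play no role.
\<close>

definition Lp :: "real \<Rightarrow> real \<Rightarrow> (real \<Rightarrow> 'a::real_normed_vector) set" where
  "Lp p \<alpha> = {f \<in> borel_measurable (bessel_measure \<alpha>). eLp_norm p (bessel_measure \<alpha>) f < \<infinity>}"

definition Lp_bounded :: "real \<Rightarrow> real \<Rightarrow> (real \<Rightarrow> 'a::real_normed_vector) set \<Rightarrow> bool" where
  "Lp_bounded p \<alpha> K \<longleftrightarrow> (\<exists>C::real. \<forall>f\<in>K. eLp_norm p (bessel_measure \<alpha>) f \<le> ennreal C)"

text \<open>
  This is \<^const>\<open>Metric_space.mtotally_bounded\<close> written out for the pseudometric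
  of \<open>Lp\<close>; the locale itself requires a genuine metric.
\<close>

definition Lp_totally_bounded :: "real \<Rightarrow> real \<Rightarrow> (real \<Rightarrow> 'a::real_normed_vector) set \<Rightarrow> bool" where
  "Lp_totally_bounded p \<alpha> K \<longleftrightarrow>
     (\<forall>\<epsilon>::real>0. \<exists>F. finite F \<and> F \<subseteq> K \<and>
        (\<forall>f\<in>K. \<exists>g\<in>F. eLp_norm p (bessel_measure \<alpha>) (\<lambda>x. g x - f x) < ennreal \<epsilon>))"

definition bessel_const :: "real \<Rightarrow> real" where
  "bessel_const \<alpha> = inverse (LINT \<phi>:{0..pi}|lebesgue. sin \<phi> powr (2 * \<alpha>))"

text \<open>
  The case \<open>\<alpha> = - 1 / 2\<close> is the weak limit of the probability measures
  \<open>c\<^sub>\<alpha> sin\<^sup>2\<^sup>\<alpha> \<phi> d\<phi>\<close>, namely half the sum of the point masses at 0 and \<open>\<pi>\<close>. For \<open>f\<close> in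
  \<open>Lp\<close> and \<open>\<alpha> > - 1 / 2\<close> the integrand below is integrable for almost every \<open>s\<close>; at the remaining
  points the integral takes the default value 0.
\<close>

definition bessel_translation ::
    "real \<Rightarrow> real \<Rightarrow> (real \<Rightarrow> 'a::{banach, second_countable_topology}) \<Rightarrow> real \<Rightarrow> 'a" where
  "bessel_translation \<alpha> t f s =
     (if \<alpha> = - 1 / 2 then (1 / 2) *\<^sub>R (f (s + t) + f \<bar>s - t\<bar>)
      else LINT \<phi>:{0..pi}|lebesgue.
             (bessel_const \<alpha> * sin \<phi> powr (2 * \<alpha>)) *\<^sub>R f (sqrt (t\<^sup>2 + s\<^sup>2 - 2 * s * t * cos \<phi>)))"

definition equivanishing :: "real \<Rightarrow> real \<Rightarrow> (real \<Rightarrow> 'a::real_normed_vector) set \<Rightarrow> bool" where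
  "equivanishing p \<alpha> K \<longleftrightarrow>
     (\<forall>\<epsilon>::real>0. \<exists>R>0. \<forall>f\<in>K. eLp_norm p (restrict_space (bessel_measure \<alpha>) {R..}) f < ennreal \<epsilon>)"

definition Lp_equicontinuous ::
    "real \<Rightarrow> real \<Rightarrow> (real \<Rightarrow> 'a::{banach, second_countable_topology}) set \<Rightarrow> bool" where
  "Lp_equicontinuous p \<alpha> K \<longleftrightarrow>
     (\<forall>\<epsilon>::real>0. \<forall>M\<^sub>0>0. \<exists>\<delta>>0. \<forall>h. 0 \<le> h \<and> h \<le> \<delta> \<longrightarrow> (\<forall>f\<in>K. \<forall>t\<in>{0..M\<^sub>0}.
        eLp_norm p (bessel_measure \<alpha>)
          (\<lambda>s. bessel_translation \<alpha> (t + h) f s - bessel_translation \<alpha> t f s) < ennreal \<epsilon>))"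

end

theory Submission
  imports Defs "HOL-Probability.Probability_Measure"
begin

text \<open>
  The Bessel translation is ordinary translation seen through radial functions. Extend \<open>f\<close> to the
  half plane by \<open>(x, y) \<mapsto> f (\<bar>(x, y)\<bar>)\<close>. By the law of cosines, \<open>T\<^sub>t f (s)\<close> is the mean of this
  extension over the points \<open>(t - s cos \<phi>, s sin \<phi>)\<close> of a half circle, and in polar coordinates the
  measure \<open>s\<^sup>2\<^sup>\<alpha>\<^sup>+\<^sup>1 ds d\<mu>(\<phi>)\<close> becomes a multiple of \<open>y\<^sup>2\<^sup>\<alpha> dx dy\<close>, which is invariant under
  translations and reflections in \<open>x\<close>. For \<open>\<alpha> = - 1 / 2\<close> the half circle shrinks to its two end
  points and the plane measure to Lebesgue measure on the line \<open>y = 0\<close>. This invariance is the only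
  property of the Bessel setting that the compactness argument uses, together with the facts that the
  radial measure \<open>\<nu>\<close> is absolutely continuous, finite on bounded intervals and positive near 0; they
  form the locale \<open>radial_translation\<close>. Below, \<open>pint f\<close> is \<open>\<integral> \<bar>f\<bar>\<^sup>p d\<nu>\<close>. Working with \<open>p\<close>-th powers of
  norms, the bound \<open>\<bar>a + b + c\<bar>\<^sup>p \<le> 3\<^sup>p (\<bar>a\<bar>\<^sup>p + \<bar>b\<bar>\<^sup>p + \<bar>c\<bar>\<^sup>p)\<close> replaces the inequality of
  Minkowski everywhere.

  Total boundedness implies both conditions by a finite net, provided single functions satisfy them. For
  the tails this is dominated convergence. For the translations, Jensen's inequality and invariance
  bound \<open>pint (T\<^sub>t\<^sub>+\<^sub>h f - T\<^sub>t f)\<close> by the modulus \<open>\<integral> \<bar>f (\<bar>z + h e\<^sub>1\<bar>) - f (\<bar>z\<bar>)\<bar>\<^sup>p\<close> over the plane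
  (\<open>pint_translate_diff_le_modulus\<close>), in which \<open>t\<close> no longer occurs; it tends to 0 with \<open>h\<close> because this
  is clear for continuous functions of compact support and those are dense (\<open>modulus_tendsto_0\<close>).

  Conversely, let \<open>A f (s)\<close> be the \<open>\<nu>\<close>-mean of \<open>T\<^sub>t f (s)\<close> over \<open>t \<in> [0, \<delta>]\<close>. Equicontinuity at \<open>t = 0\<close>
  makes \<open>A f\<close> uniformly close to \<open>f\<close> in \<open>L\<^sub>p\<close> (\<open>pint_average_diff_le\<close>). The symmetry
  \<open>T\<^sub>t f (s) = T\<^sub>s f (t)\<close> turns equicontinuity for \<open>t \<in> [0, R]\<close> into pointwise equicontinuity of the
  functions \<open>A f\<close> on \<open>[0, R]\<close> (\<open>norm_average_diff_powr_le\<close>), and contractivity of \<open>T\<^sub>s\<close> into a pointwise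
  bound. So the values of \<open>A f\<close> at finitely many grid points, rounded to a finite net of a ball, sort
  \<open>K\<close> into finitely many classes within each of which the functions \<open>A f\<close> are close to each other on \<open>[0, R]\<close>
  (\<open>equi_imp_finite_classes\<close>). Equivanishing takes care of \<open>[R, \<infinity>)\<close>, and one representative of each class
  gives the net.

  Elements of \<open>L\<^sub>p\<close> are Lebesgue measurable, and composing with them need not be measurable. Each is
  therefore replaced by a Borel function that agrees with it almost everywhere; invariance shows that
  null sets are invisible to the translation (\<open>bessel_translation_eq_translate\<close>).
\<close>

section \<open>Powers of norms and their integrals\<close>

text \<open>
  A crude bound, through the largest of the three norms, suffices: it serves as the triangle
  inequality for \<open>p\<close>-th powers, at the price of the constant \<open>3\<^sup>p\<close>.
\<close>

lemma norm_add3_powr_le: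
  fixes a b c :: "'a::real_normed_vector"
  assumes "p \<ge> 0"
  shows "norm (a + b + c) powr p \<le> 3 powr p * (norm a powr p + norm b powr p + norm c powr p)"
proof -
  define m where "m = max (norm a) (max (norm b) (norm c))"
  have "norm (a + b + c) \<le> norm a + norm b + norm c"
    by (meson add_mono norm_triangle_ineq order_trans order_refl)
  also have "\<dots> \<le> 3 * m" by (simp add: m_def)
  finally have "norm (a + b + c) powr p \<le> (3 * m) powr p"
    using assms by (intro powr_mono2) auto
  also have "\<dots> = 3 powr p * m powr p"
    by (simp add: powr_mult)
  also have "m powr p \<le> norm a powr p + norm b powr p + norm c powr p"
    unfolding m_def max_def by auto
  finally show ?thesis by simp
qed

text \<open>
  The tangent at \<open>m\<close> supports the graph of the convex function \<open>x\<^sup>p\<close>. Convexity is used on the open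
  half line, where the power is differentiable; the end point 0 is checked by hand.
\<close>

lemma powr_above_tangent:
  fixes x m p :: real
  assumes "1 \<le> p" "0 \<le> x" "0 < m"
  shows "m powr p + p * m powr (p - 1) * (x - m) \<le> x powr p"
proof (cases "x = 0")
  case True
  have "m powr p = m powr (1 + (p - 1))" by simp
  also have "\<dots> = m * m powr (p - 1)"
    unfolding powr_add using assms(3) by simp
  finally have "m powr p + p * m powr (p - 1) * (x - m) = (1 - p) * (m * m powr (p - 1))"
    unfolding True by (simp only: left_diff_distrib) simp
  also have "\<dots> \<le> 0" using assms by (intro mult_nonpos_nonneg mult_nonneg_nonneg) auto
  also have "\<dots> \<le> x powr p" by (rule powr_ge_zero)
  finally show ?thesis .
next
  case False
  have der: "((\<lambda>x. x powr p) has_real_derivative p * m powr (p - 1)) (at m within {0<..})"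
    by (rule has_field_derivative_at_within[OF has_real_derivative_powr[OF assms(3)]])
  have "m \<in> interior {0<..}" "x \<in> {0<..}"
    using assms False by (auto simp: interior_open[OF open_greaterThan])
  from convex_on_imp_above_tangent[OF powr_convex[OF assms(1)] connected_Ioi this der]
  have "p * m powr (p - 1) * (x - m) \<le> x powr p - m powr p" .
  then show ?thesis by simp
qed

text \<open>
  On a finite measure space, \<open>r \<le> 1 + r\<^sup>p\<close> dominates the norm by an integrable function.
\<close>

lemma (in finite_measure) integrable_if_powr_integral_finite:
  fixes f :: "'a \<Rightarrow> 'b::{banach, second_countable_topology}"
  assumes [measurable]: "f \<in> borel_measurable M" and p: "1 \<le> p"
    and fin: "(\<integral>\<^sup>+x. ennreal (norm (f x) powr p) \<partial>M) < \<infinity>"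
  shows "integrable M f"
proof (rule integrableI_bounded)
  have le: "r \<le> 1 + r powr p" if "r \<ge> 0" for r :: real
  proof (cases "r \<le> 1")
    case False
    then show ?thesis using powr_mono[of 1 p r] p by simp
  qed (use that in \<open>simp add: add_increasing2\<close>)
  have "(\<integral>\<^sup>+x. ennreal (norm (f x)) \<partial>M) \<le> (\<integral>\<^sup>+x. 1 + ennreal (norm (f x) powr p) \<partial>M)"
    using le by (intro nn_integral_mono) (simp flip: ennreal_1 ennreal_plus)
  also have "\<dots> = emeasure M (space M) + (\<integral>\<^sup>+x. ennreal (norm (f x) powr p) \<partial>M)"
    by (subst nn_integral_add) auto
  also have "\<dots> < \<infinity>"
    using fin by (simp add: less_top[symmetric])
  finally show "(\<integral>\<^sup>+x. ennreal (norm (f x)) \<partial>M) < \<infinity>" .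
qed fact

text \<open>
  Jensen's inequality for \<open>v \<mapsto> \<bar>v\<bar>\<^sup>p\<close>. It holds for every measurable \<open>f\<close>: if \<open>f\<close> is not integrable, its
  Bochner integral is 0. Otherwise the tangent at the mean \<open>m\<close> of \<open>\<bar>f\<bar>\<close> is integrated.
\<close>

lemma (in prob_space) norm_integral_powr_le:
  fixes f :: "'a \<Rightarrow> 'b::{banach, second_countable_topology}"
  assumes f[measurable]: "f \<in> borel_measurable M" and p: "1 \<le> p"
  shows "ennreal (norm (\<integral>x. f x \<partial>M) powr p) \<le> (\<integral>\<^sup>+x. ennreal (norm (f x) powr p) \<partial>M)"
proof (cases "(\<integral>\<^sup>+x. ennreal (norm (f x) powr p) \<partial>M) = \<infinity> \<or> (\<integral>x. f x \<partial>M) = 0")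
  case False
  then have fin: "(\<integral>\<^sup>+x. ennreal (norm (f x) powr p) \<partial>M) < \<infinity>"
    and pos: "0 < norm (\<integral>x. f x \<partial>M)"
    by (simp_all add: less_top)
  define m where "m = (\<integral>x. norm (f x) \<partial>M)"
  have int: "integrable M f"
    by (rule integrable_if_powr_integral_finite[OF f p fin])
  have intp: "integrable M (\<lambda>x. norm (f x) powr p)"
    using fin by (intro integrableI_nonneg) auto
  have nm: "norm (\<integral>x. f x \<partial>M) \<le> m"
    unfolding m_def by (rule integral_norm_bound)
  with pos have m: "m > 0" by linarith
  define c where "c = p * m powr (p - 1)"
  have intn: "integrable M (\<lambda>x. norm (f x))" using int by (rule integrable_norm)
  \<comment> \<open>the tangent at the mean \<open>m\<close> integrates to its value \<open>m\<^sup>p\<close> at \<open>m\<close>\<close>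
  have "m powr p = (\<integral>x. (m powr p - c * m) + c * norm (f x) \<partial>M)"
    using intn by (simp add: prob_space flip: m_def)
  also have "\<dots> \<le> (\<integral>x. norm (f x) powr p \<partial>M)"
  proof (rule integral_mono)
    show "integrable M (\<lambda>x. (m powr p - c * m) + c * norm (f x))" using intn by simp
    show "(m powr p - c * m) + c * norm (f x) \<le> norm (f x) powr p" for x
      using powr_above_tangent[OF p norm_ge_zero m, of "f x"] by (simp add: c_def algebra_simps)
  qed (rule intp)
  finally have "norm (\<integral>x. f x \<partial>M) powr p \<le> (\<integral>x. norm (f x) powr p \<partial>M)"
    using nm p powr_mono2[of p "norm (\<integral>x. f x \<partial>M)" m] by simp
  then have "ennreal (norm (\<integral>x. f x \<partial>M) powr p) \<le> ennreal (\<integral>x. norm (f x) powr p \<partial>M)"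
    by (rule ennreal_leI)
  also have "\<dots> = (\<integral>\<^sup>+x. ennreal (norm (f x) powr p) \<partial>M)"
    using intp by (intro nn_integral_eq_integral[symmetric]) auto
  finally show ?thesis .
next
  case True
  then show ?thesis
  proof
    assume "(\<integral>\<^sup>+x. ennreal (norm (f x) powr p) \<partial>M) = \<infinity>"
    then show ?thesis by (simp only: infinity_ennreal_def top_greatest)
  next
    assume 0: "(\<integral>x. f x \<partial>M) = 0"
    have "ennreal (norm (\<integral>x. f x \<partial>M) powr p) = 0" unfolding 0 by simp
    then show ?thesis by (simp only: zero_le)
  qed
qed

section \<open>Polar coordinates in the upper half plane\<close>

lemma borel_measurable_tan [measurable]: "(tan :: real \<Rightarrow> real) \<in> borel_measurable borel"
proof -
  have "(\<lambda>x::real. sin x / cos x) \<in> borel_measurable borel" by measurable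
  then show ?thesis by (simp add: tan_def[abs_def])
qed

text \<open>
  The substitution \<open>u = tan t\<close> as an identity of measures. By the fundamental theorem of calculus both
  sides agree on intervals, and a Borel measure is determined by its finite values there. In this form the
  substitution applies to arbitrary nonnegative Borel integrands.
\<close>

lemma lborel_eq_distr_tan:
  "lborel = distr (density lborel (\<lambda>t. ennreal (indicator {-(pi/2)<..<pi/2} t / (cos t)\<^sup>2))) borel tan"
proof (rule lborel_eqI)
  fix l u :: real
  assume "\<And>b. b \<in> Basis \<Longrightarrow> l \<bullet> b \<le> u \<bullet> b"
  from this[of 1] have lu: "l \<le> u" by simp
  let ?J = "{-(pi/2)<..<pi/2}"
  have in_iff: "tan t \<in> {l<..<u} \<longleftrightarrow> t \<in> {arctan l<..<arctan u}" if "t \<in> ?J" for t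
    using that arctan_tan[of t] arctan_less_iff[of l "tan t"] arctan_less_iff[of "tan t" u] by auto
  have sub: "t \<in> ?J" if "t \<in> {arctan l..arctan u}" for t
    using that arctan_bounded[of l] arctan_bounded[of u] by auto
  let ?D = "density lborel (\<lambda>t. ennreal (indicator ?J t / (cos t)\<^sup>2))"
  have pre: "tan -` {l<..<u} \<in> sets borel"
    using measurable_sets_borel[OF borel_measurable_tan, of "{l<..<u}"] by simp
  have "emeasure (distr ?D borel tan) (box l u) = emeasure ?D (tan -` {l<..<u})"
    by (subst emeasure_distr) (auto simp: box_real borel_measurable_tan)
  also have "\<dots> = (\<integral>\<^sup>+t. ennreal (indicator ?J t / (cos t)\<^sup>2) * indicator (tan -` {l<..<u}) t \<partial>lborel)"
    using pre by (intro emeasure_density) auto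
  also have "\<dots> = (\<integral>\<^sup>+t. ennreal (inverse ((cos t)\<^sup>2)) * indicator {arctan l..arctan u} t \<partial>lborel)"
  proof (rule nn_integral_cong_AE)
    have "AE t in lborel. t \<noteq> arctan l \<and> t \<noteq> arctan u"
      by (intro AE_conjI AE_lborel_singleton)
    then show "AE t in lborel. ennreal (indicator ?J t / (cos t)\<^sup>2) * indicator (tan -` {l<..<u}) t
        = ennreal (inverse ((cos t)\<^sup>2)) * indicator {arctan l..arctan u} t"
    proof eventually_elim
      case (elim t)
      then show ?case using in_iff[of t] sub[of t]
        by (auto simp: indicator_def inverse_eq_divide)
    qed
  qed
  also have "\<dots> = ennreal (tan (arctan u) - tan (arctan l))"
  proof (rule nn_integral_FTC_Icc[where F = tan])
    fix t assume t: "t \<in> {arctan l..arctan u}"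
    from sub[OF t] have "cos t > 0" by (intro cos_gt_zero_pi) auto
    then show "DERIV tan t :> inverse ((cos t)\<^sup>2)" by (intro DERIV_tan) simp
  next
    show "(\<lambda>t. inverse ((cos t)\<^sup>2) :: real) \<in> borel_measurable borel" by measurable
  qed (auto simp: lu arctan_le_iff)
  finally show "emeasure (distr ?D borel tan) (box l u) = ennreal (\<Prod>b\<in>Basis. (u - l) \<bullet> b)"
    using arctan[of u] arctan[of l] by simp
qed simp

lemma nn_integral_tan_substitution:
  assumes [measurable]: "g \<in> borel_measurable borel"
  shows "(\<integral>\<^sup>+u. g u \<partial>lborel) =
    (\<integral>\<^sup>+t. ennreal (indicator {-(pi/2)<..<pi/2} t / (cos t)\<^sup>2) * g (tan t) \<partial>lborel)"
proof -
  show ?thesis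
    by (subst lborel_eq_distr_tan) (simp add: nn_integral_distr nn_integral_density)
qed

text \<open>
  Polar coordinates by three one-dimensional substitutions: \<open>x = y u\<close> for fixed \<open>y\<close>, then \<open>u = tan t\<close>, then
  \<open>y = s cos t\<close> for fixed \<open>t\<close>. Here \<open>t\<close> is the angle from the \<open>y\<close>-axis, and a final reflection
  \<open>t \<mapsto> \<pi> / 2 - t\<close> restores the usual angle.
\<close>

lemma nn_integral_polar_upper_half_plane:
  fixes F :: "real \<times> real \<Rightarrow> ennreal"
  assumes [measurable]: "F \<in> borel_measurable borel"
  shows "(\<integral>\<^sup>+y. indicator {0<..} y * (\<integral>\<^sup>+x. F (x, y) \<partial>lborel) \<partial>lborel)
    = (\<integral>\<^sup>+s. ennreal (indicator {0<..} s * s) *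
         (\<integral>\<^sup>+t. indicator {0<..<pi} t * F (s * cos t, s * sin t) \<partial>lborel) \<partial>lborel)"
proof -
  have [measurable]: "F \<in> borel_measurable (borel \<Otimes>\<^sub>M borel)" by (simp add: borel_prod)
  let ?J = "{-(pi/2)<..<pi/2}"
  have "(\<integral>\<^sup>+y. indicator {0<..} y * (\<integral>\<^sup>+x. F (x, y) \<partial>lborel) \<partial>lborel)
      = (\<integral>\<^sup>+y. (\<integral>\<^sup>+t. ennreal (indicator ?J t / (cos t)\<^sup>2) *
            (ennreal (indicator {0<..} y * y) * F (y * tan t, y)) \<partial>lborel) \<partial>lborel)"
  proof (rule nn_integral_cong)
    fix y :: real
    show "indicator {0<..} y * (\<integral>\<^sup>+x. F (x, y) \<partial>lborel) =
      (\<integral>\<^sup>+t. ennreal (indicator ?J t / (cos t)\<^sup>2) *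
            (ennreal (indicator {0<..} y * y) * F (y * tan t, y)) \<partial>lborel)"
    proof (cases "y > 0")
      case True
      have "(\<integral>\<^sup>+x. F (x, y) \<partial>lborel) = ennreal y * (\<integral>\<^sup>+u. F (y * u, y) \<partial>lborel)"
        using nn_integral_real_affine[of "\<lambda>x. F (x, y)" y 0] True by simp
      also have "\<dots> = (\<integral>\<^sup>+u. ennreal y * F (y * u, y) \<partial>lborel)"
        by (rule nn_integral_cmult[symmetric]) measurable
      also have "\<dots> = (\<integral>\<^sup>+t. ennreal (indicator ?J t / (cos t)\<^sup>2) * (ennreal y * F (y * tan t, y)) \<partial>lborel)"
        by (rule nn_integral_tan_substitution) measurable
      finally show ?thesis using True by simp
    qed simp
  qed
  also have "\<dots> = (\<integral>\<^sup>+t. (\<integral>\<^sup>+y. ennreal (indicator ?J t / (cos t)\<^sup>2) *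
            (ennreal (indicator {0<..} y * y) * F (y * tan t, y)) \<partial>lborel) \<partial>lborel)"
    by (rule lborel_pair.Fubini') measurable
  also have "\<dots> = (\<integral>\<^sup>+t. (\<integral>\<^sup>+s. ennreal (indicator ?J t) *
            (ennreal (indicator {0<..} s * s) * F (s * sin t, s * cos t)) \<partial>lborel) \<partial>lborel)"
  proof (rule nn_integral_cong)
    fix t :: real
    show "(\<integral>\<^sup>+y. ennreal (indicator ?J t / (cos t)\<^sup>2) *
            (ennreal (indicator {0<..} y * y) * F (y * tan t, y)) \<partial>lborel)
       = (\<integral>\<^sup>+s. ennreal (indicator ?J t) *
            (ennreal (indicator {0<..} s * s) * F (s * sin t, s * cos t)) \<partial>lborel)"
    proof (cases "t \<in> ?J")
      case True
      then have c: "cos t > 0" by (intro cos_gt_zero_pi) auto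
      have tan: "s * cos t * tan t = s * sin t" for s using c by (simp add: tan_def)
      have "(\<integral>\<^sup>+y. ennreal (1 / (cos t)\<^sup>2) * (ennreal (indicator {0<..} y * y) * F (y * tan t, y)) \<partial>lborel)
        = ennreal (cos t) * (\<integral>\<^sup>+s. ennreal (1 / (cos t)\<^sup>2) * (ennreal (indicator {0<..} (cos t * s) * (cos t * s)) * F (cos t * s * tan t, cos t * s)) \<partial>lborel)"
        using nn_integral_real_affine[of "\<lambda>y. ennreal (1 / (cos t)\<^sup>2) * (ennreal (indicator {0<..} y * y) * F (y * tan t, y))" "cos t" 0] c
        by simp
      also have "\<dots> = (\<integral>\<^sup>+s. ennreal (cos t) * (ennreal (1 / (cos t)\<^sup>2) * (ennreal (indicator {0<..} (cos t * s) * (cos t * s)) * F (cos t * s * tan t, cos t * s))) \<partial>lborel)"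
        by (rule nn_integral_cmult[symmetric]) measurable
      also have "\<dots> = (\<integral>\<^sup>+s. ennreal (indicator {0<..} s * s) * F (s * sin t, s * cos t) \<partial>lborel)"
      proof (rule nn_integral_cong)
        fix s :: real
        have "cos t * (1 / (cos t)\<^sup>2 * (indicator {0<..} (cos t * s) * (cos t * s))) = indicator {0<..} s * s"
          using c by (auto simp: indicator_def zero_less_mult_iff power2_eq_square)
        then have "ennreal (cos t) * (ennreal (1 / (cos t)\<^sup>2) * ennreal (indicator {0<..} (cos t * s) * (cos t * s))) = ennreal (indicator {0<..} s * s)"
          using c by (simp flip: ennreal_mult' )
        then show "ennreal (cos t) * (ennreal (1 / (cos t)\<^sup>2) * (ennreal (indicator {0<..} (cos t * s) * (cos t * s)) * F (cos t * s * tan t, cos t * s)))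
          = ennreal (indicator {0<..} s * s) * F (s * sin t, s * cos t)"
          by (simp only: mult.assoc[symmetric] mult.commute[of "cos t" s] tan)
      qed
      finally show ?thesis using True by simp
    qed simp
  qed
  also have "\<dots> = (\<integral>\<^sup>+s. (\<integral>\<^sup>+t. ennreal (indicator ?J t) *
            (ennreal (indicator {0<..} s * s) * F (s * sin t, s * cos t)) \<partial>lborel) \<partial>lborel)"
    by (rule lborel_pair.Fubini') measurable
  also have "\<dots> = (\<integral>\<^sup>+s. ennreal (indicator {0<..} s * s) *
         (\<integral>\<^sup>+t. indicator {0<..<pi} t * F (s * cos t, s * sin t) \<partial>lborel) \<partial>lborel)"
  proof (rule nn_integral_cong)
    fix s :: real
    have "(\<integral>\<^sup>+t. ennreal (indicator ?J t) * (ennreal (indicator {0<..} s * s) * F (s * sin t, s * cos t)) \<partial>lborel)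
      = (\<integral>\<^sup>+t. ennreal (indicator ?J (pi/2 - t)) * (ennreal (indicator {0<..} s * s) * F (s * cos t, s * sin t)) \<partial>lborel)"
      using nn_integral_real_affine[of "\<lambda>t. ennreal (indicator ?J t) * (ennreal (indicator {0<..} s * s) * F (s * sin t, s * cos t))" "-1" "pi/2"]
      by (simp add: sin_diff cos_diff)
    also have "\<dots> = (\<integral>\<^sup>+t. ennreal (indicator {0<..} s * s) * (indicator {0<..<pi} t * F (s * cos t, s * sin t)) \<partial>lborel)"
      by (intro nn_integral_cong) (auto simp: indicator_def)
    also have "\<dots> = ennreal (indicator {0<..} s * s) * (\<integral>\<^sup>+t. indicator {0<..<pi} t * F (s * cos t, s * sin t) \<partial>lborel)"
      by (rule nn_integral_cmult) measurable
    finally show "(\<integral>\<^sup>+t. ennreal (indicator ?J t) * (ennreal (indicator {0<..} s * s) * F (s * sin t, s * cos t)) \<partial>lborel)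
      = ennreal (indicator {0<..} s * s) * (\<integral>\<^sup>+t. indicator {0<..<pi} t * F (s * cos t, s * sin t) \<partial>lborel)" .
  qed
  finally show ?thesis .
qed

section \<open>Translations induced by a shift-invariant radial measure\<close>

text \<open>
  \<open>\<nu>\<close> is the distribution of the radius \<open>s\<close> and \<open>\<mu>\<close> that of \<open>w = cos \<phi>\<close>. The point with polar coordinates
  \<open>s\<close>, \<open>\<phi>\<close> is \<open>(s w, s \<surd>(1 - w\<^sup>2))\<close>; \<open>shift_invariant\<close> says that the image of \<open>\<nu> \<otimes> \<mu>\<close> in the plane, reflected
  in the \<open>y\<close>-axis, is invariant under translations along the \<open>x\<close>-axis. Using the cosine in place of the angle
  covers the two-point law of the limiting case as well.
\<close>

locale radial_translation = mu: prob_space \<mu> + nu: sigma_finite_measure \<nu>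
  for \<mu> \<nu> :: "real measure" +
  fixes p :: real
  assumes p_ge_1: "1 \<le> p"
    and sets_mu [measurable_cong]: "sets \<mu> = sets borel"
    and sets_nu [measurable_cong]: "sets \<nu> = sets borel"
    and AE_mu: "AE w in \<mu>. w \<in> {-1..1}"
    and AE_nu: "AE s in \<nu>. 0 \<le> s"
    and nu_finite: "emeasure \<nu> {0..R} < \<infinity>"
    and nu_pos: "0 < \<delta> \<Longrightarrow> 0 < emeasure \<nu> {0..\<delta>}"
    and AE_nu_if_AE_lborel: "(AE s in lborel. P s) \<Longrightarrow> (AE s in \<nu>. P s)"
    and shift_invariant: "F \<in> borel_measurable borel \<Longrightarrow>
      (\<integral>\<^sup>+s. \<integral>\<^sup>+w. F (t - s * w, s * sqrt (1 - w\<^sup>2)) \<partial>\<mu> \<partial>\<nu>) =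
      (\<integral>\<^sup>+s. \<integral>\<^sup>+w. F (- (s * w), s * sqrt (1 - w\<^sup>2)) \<partial>\<mu> \<partial>\<nu>)"
begin

sublocale nu_mu: pair_sigma_finite \<nu> \<mu> ..

text \<open>
  The law of cosines: the distance of \<open>(t, 0)\<close> from the point at radius \<open>s\<close> whose angle has cosine \<open>w\<close>.
\<close>

definition rad :: "real \<Rightarrow> real \<Rightarrow> real \<Rightarrow> real" where
  "rad t s w = sqrt (t\<^sup>2 + s\<^sup>2 - 2 * s * t * w)"

lemma rad_eq_norm:
  assumes "w \<in> {-1..1}"
  shows "rad t s w = norm (t - s * w, s * sqrt (1 - w\<^sup>2))"
proof -
  have "w\<^sup>2 \<le> 1"
    using assms by (simp add: abs_square_le_1 abs_le_iff)
  then have "(t - s * w)\<^sup>2 + (s * sqrt (1 - w\<^sup>2))\<^sup>2 = t\<^sup>2 + s\<^sup>2 - 2 * s * t * w"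
    by (simp add: power_mult_distrib algebra_simps power2_eq_square)
  then show ?thesis
    by (simp add: rad_def norm_Pair)
qed

lemma rad_commute: "rad t s w = rad s t w"
  by (simp add: rad_def algebra_simps)

lemma rad_0 [simp]: "0 \<le> s \<Longrightarrow> rad 0 s w = s"
  by (simp add: rad_def)

lemma rad_measurable [measurable (raw)]:
  assumes [measurable]: "f \<in> borel_measurable N" "g \<in> borel_measurable N" "h \<in> borel_measurable N"
  shows "(\<lambda>x. rad (f x) (g x) (h x)) \<in> borel_measurable N"
  unfolding rad_def by measurable

lemma nn_integral_cong_mu_nu:
  assumes "\<And>s w. 0 \<le> s \<Longrightarrow> w \<in> {-1..1} \<Longrightarrow> f s w = g s w"
  shows "(\<integral>\<^sup>+s. \<integral>\<^sup>+w. f s w \<partial>\<mu> \<partial>\<nu>) = (\<integral>\<^sup>+s. \<integral>\<^sup>+w. g s w \<partial>\<mu> \<partial>\<nu>)"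
  using AE_nu by (intro nn_integral_cong_AE, eventually_elim)
    (auto intro!: nn_integral_cong_AE eventually_mono[OF AE_mu] assms)

text \<open>
  Shift invariance for functions of the two distances \<open>\<bar>z + h e\<^sub>1\<bar>\<close> and \<open>\<bar>z\<bar>\<close>. Pairs are needed because
  differences of two translates have to be estimated.
\<close>

lemma nn_integral_rad_pair_shift:
  assumes [measurable]: "G \<in> borel_measurable (borel \<Otimes>\<^sub>M borel)"
  shows "(\<integral>\<^sup>+s. \<integral>\<^sup>+w. G (rad (t + h) s w, rad t s w) \<partial>\<mu> \<partial>\<nu>) =
    (\<integral>\<^sup>+s. \<integral>\<^sup>+w. G (rad h s w, rad 0 s w) \<partial>\<mu> \<partial>\<nu>)"
proof -
  define F :: "real \<times> real \<Rightarrow> ennreal" where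
    "F = (\<lambda>(x, y). G (sqrt ((x + h)\<^sup>2 + y\<^sup>2), sqrt (x\<^sup>2 + y\<^sup>2)))"
  have [measurable]: "F \<in> borel_measurable borel"
    unfolding F_def borel_prod[symmetric] by measurable
  have F: "F (t - s * w, s * sqrt (1 - w\<^sup>2)) = G (rad (t + h) s w, rad t s w)"
    if "w \<in> {-1..1}" for t s w
    using that by (simp add: F_def rad_eq_norm norm_Pair algebra_simps)
  have F0: "F (- (s * w), s * sqrt (1 - w\<^sup>2)) = G (rad h s w, rad 0 s w)"
    if "w \<in> {-1..1}" for s w
    using F[OF that, of 0 s] by simp
  have "(\<integral>\<^sup>+s. \<integral>\<^sup>+w. G (rad (t + h) s w, rad t s w) \<partial>\<mu> \<partial>\<nu>)
      = (\<integral>\<^sup>+s. \<integral>\<^sup>+w. F (t - s * w, s * sqrt (1 - w\<^sup>2)) \<partial>\<mu> \<partial>\<nu>)"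
    by (intro nn_integral_cong_mu_nu F[symmetric])
  also have "\<dots> = (\<integral>\<^sup>+s. \<integral>\<^sup>+w. F (- (s * w), s * sqrt (1 - w\<^sup>2)) \<partial>\<mu> \<partial>\<nu>)"
    by (rule shift_invariant) measurable
  also have "\<dots> = (\<integral>\<^sup>+s. \<integral>\<^sup>+w. G (rad h s w, rad 0 s w) \<partial>\<mu> \<partial>\<nu>)"
    by (intro nn_integral_cong_mu_nu F0)
  finally show ?thesis .
qed

text \<open>
  At \<open>t = 0\<close> the distance is the radius \<open>s\<close>, and \<open>\<mu>\<close> integrates out. Hence the translation preserves integrals.
\<close>

lemma nn_integral_rad:
  assumes [measurable]: "G \<in> borel_measurable borel"
  shows "(\<integral>\<^sup>+s. \<integral>\<^sup>+w. G (rad t s w) \<partial>\<mu> \<partial>\<nu>) = (\<integral>\<^sup>+s. G s \<partial>\<nu>)"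
proof -
  have "(\<integral>\<^sup>+s. \<integral>\<^sup>+w. G (rad t s w) \<partial>\<mu> \<partial>\<nu>) = (\<integral>\<^sup>+s. \<integral>\<^sup>+w. G (rad 0 s w) \<partial>\<mu> \<partial>\<nu>)"
    using nn_integral_rad_pair_shift[of "\<lambda>(a, b). G b" t 0] by simp
  also have "\<dots> = (\<integral>\<^sup>+s. \<integral>\<^sup>+w. G s \<partial>\<mu> \<partial>\<nu>)"
    by (intro nn_integral_cong_mu_nu) simp
  finally show ?thesis
    by (simp add: mu.emeasure_space_1)
qed

text \<open>
  Applied to the indicator of an exceptional set: translation does not see \<open>\<nu>\<close>-null sets.
\<close>

lemma AE_rad:
  assumes "AE x in \<nu>. P x" and [measurable]: "Measurable.pred borel P"
  shows "AE s in \<nu>. AE w in \<mu>. P (rad t s w)"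
proof -
  have "(\<integral>\<^sup>+s. \<integral>\<^sup>+w. indicator {x. \<not> P x} (rad t s w) \<partial>\<mu> \<partial>\<nu>) = (\<integral>\<^sup>+s. indicator {x. \<not> P x} s \<partial>\<nu>)"
    by (rule nn_integral_rad) measurable
  also have "\<dots> = (\<integral>\<^sup>+s. 0 \<partial>\<nu>)"
    using assms(1) by (intro nn_integral_cong_AE) (auto simp: indicator_def elim: eventually_mono)
  finally have "(\<integral>\<^sup>+s. \<integral>\<^sup>+w. indicator {x. \<not> P x} (rad t s w) \<partial>\<mu> \<partial>\<nu>) = 0"
    by simp
  then have "AE s in \<nu>. (\<integral>\<^sup>+w. indicator {x. \<not> P x} (rad t s w) \<partial>\<mu>) = 0"
    by (subst (asm) nn_integral_0_iff_AE) measurable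
  then show ?thesis
    by eventually_elim (subst (asm) nn_integral_0_iff_AE, auto simp: indicator_def split: if_splits)
qed

definition translate :: "real \<Rightarrow> (real \<Rightarrow> 'a::{banach, second_countable_topology}) \<Rightarrow> real \<Rightarrow> 'a" where
  "translate t f s = (\<integral>w. f (rad t s w) \<partial>\<mu>)"

definition pint :: "(real \<Rightarrow> 'a::real_normed_vector) \<Rightarrow> ennreal" where
  "pint f = (\<integral>\<^sup>+s. ennreal (norm (f s) powr p) \<partial>\<nu>)"

text \<open>
  The \<open>p\<close>-th power of the \<open>L\<^sub>p\<close>-distance, over the plane, between the radial extension of \<open>f\<close> and its
  translate by \<open>h\<close>.
\<close>

definition modulus :: "real \<Rightarrow> (real \<Rightarrow> 'a::real_normed_vector) \<Rightarrow> ennreal" where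
  "modulus h f = (\<integral>\<^sup>+s. \<integral>\<^sup>+w. ennreal (norm (f (rad h s w) - f (rad 0 s w)) powr p) \<partial>\<mu> \<partial>\<nu>)"

lemma translate_commute: "translate t f s = translate s f t"
  by (simp add: translate_def rad_commute)

lemma translate_0: "0 \<le> s \<Longrightarrow> translate 0 f s = f s"
  by (simp add: translate_def mu.prob_space)

lemma translate_measurable [measurable (raw)]:
  fixes f :: "real \<Rightarrow> 'a::{banach, second_countable_topology}"
  assumes [measurable]: "f \<in> borel_measurable borel" "g \<in> borel_measurable N" "h \<in> borel_measurable N"
  shows "(\<lambda>x. translate (g x) f (h x)) \<in> borel_measurable N"
  unfolding translate_def by measurable

lemma pint_translate_le:
  fixes f :: "real \<Rightarrow> 'a::{banach, second_countable_topology}"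
  assumes [measurable]: "f \<in> borel_measurable borel"
  shows "pint (translate t f) \<le> pint f"
proof -
  have "pint (translate t f) \<le> (\<integral>\<^sup>+s. \<integral>\<^sup>+w. ennreal (norm (f (rad t s w)) powr p) \<partial>\<mu> \<partial>\<nu>)"
    unfolding pint_def translate_def
    by (intro nn_integral_mono mu.norm_integral_powr_le p_ge_1) measurable
  also have "\<dots> = pint f"
    unfolding pint_def by (rule nn_integral_rad) measurable
  finally show ?thesis .
qed

lemma AE_integrable_rad:
  fixes f :: "real \<Rightarrow> 'a::{banach, second_countable_topology}"
  assumes [measurable]: "f \<in> borel_measurable borel" and fin: "pint f < \<infinity>"
  shows "AE s in \<nu>. integrable \<mu> (\<lambda>w. f (rad t s w))"
proof -
  have "(\<integral>\<^sup>+s. \<integral>\<^sup>+w. ennreal (norm (f (rad t s w)) powr p) \<partial>\<mu> \<partial>\<nu>) = pint f"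
    unfolding pint_def by (rule nn_integral_rad) measurable
  with fin have "AE s in \<nu>. (\<integral>\<^sup>+w. ennreal (norm (f (rad t s w)) powr p) \<partial>\<mu>) \<noteq> \<infinity>"
    by (intro nn_integral_PInf_AE) auto
  then show ?thesis
    by eventually_elim
      (intro mu.integrable_if_powr_integral_finite[OF _ p_ge_1], auto simp: less_top)
qed

text \<open>
  Jensen's inequality on each half circle reduces to the plane, where shift invariance moves \<open>t\<close> to 0.
  The linearity of the integral is available only for almost every \<open>s\<close>.
\<close>

lemma pint_translate_diff_le_modulus:
  fixes f :: "real \<Rightarrow> 'a::{banach, second_countable_topology}"
  assumes [measurable]: "f \<in> borel_measurable borel" and fin: "pint f < \<infinity>"
  shows "pint (\<lambda>s. translate (t + h) f s - translate t f s) \<le> modulus h f"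
proof -
  have "pint (\<lambda>s. translate (t + h) f s - translate t f s)
      \<le> (\<integral>\<^sup>+s. \<integral>\<^sup>+w. ennreal (norm (f (rad (t + h) s w) - f (rad t s w)) powr p) \<partial>\<mu> \<partial>\<nu>)"
    unfolding pint_def
  proof (rule nn_integral_mono_AE)
    show "AE s in \<nu>. ennreal (norm (translate (t + h) f s - translate t f s) powr p)
      \<le> (\<integral>\<^sup>+w. ennreal (norm (f (rad (t + h) s w) - f (rad t s w)) powr p) \<partial>\<mu>)"
      using AE_integrable_rad[OF assms, of "t + h"] AE_integrable_rad[OF assms, of t]
    proof eventually_elim
      case (elim s)
      have "translate (t + h) f s - translate t f s = (\<integral>w. f (rad (t + h) s w) - f (rad t s w) \<partial>\<mu>)"
        unfolding translate_def using elim by (rule Bochner_Integration.integral_diff[symmetric])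
      then show ?case
        by (simp only:) (rule mu.norm_integral_powr_le[OF _ p_ge_1], measurable)
    qed
  qed
  also have "\<dots> = modulus h f"
    unfolding modulus_def
    using nn_integral_rad_pair_shift[of "\<lambda>(a, b). ennreal (norm (f a - f b) powr p)" t h] by simp
  finally show ?thesis .
qed

lemma ennreal_norm_add3_powr_le:
  fixes a b c :: "'a::real_normed_vector"
  shows "ennreal (norm (a + b + c) powr p) \<le>
    ennreal (3 powr p) * (ennreal (norm a powr p) + ennreal (norm b powr p) + ennreal (norm c powr p))"
proof -
  have "ennreal (norm (a + b + c) powr p) \<le> ennreal (3 powr p * (norm a powr p + norm b powr p + norm c powr p))"
    using p_ge_1 by (intro ennreal_leI norm_add3_powr_le) simp
  then show ?thesis by (simp add: ennreal_mult ennreal_plus)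
qed

text \<open>
  The error \<open>f - g\<close> enters at the two distances \<open>rad h\<close> and \<open>rad 0\<close>, and invariance turns both
  contributions into \<open>pint (f - g)\<close>. So the bound holds for all \<open>h\<close> at once.
\<close>

lemma modulus_le_modulus_add:
  fixes f g :: "real \<Rightarrow> 'a::{banach, second_countable_topology}"
  assumes [measurable]: "f \<in> borel_measurable borel" "g \<in> borel_measurable borel"
  shows "modulus h f \<le> ennreal (3 powr p) * (pint (\<lambda>x. f x - g x) + pint (\<lambda>x. f x - g x) + modulus h g)"
proof -
  let ?d = "\<lambda>x. f x - g x"
  let ?n = "\<lambda>v::'a. ennreal (norm v powr p)"
  have "modulus h f \<le> (\<integral>\<^sup>+s. \<integral>\<^sup>+w. ennreal (3 powr p) *
      (?n (?d (rad h s w)) + ?n (g (rad h s w) - g (rad 0 s w)) + ?n (?d (rad 0 s w))) \<partial>\<mu> \<partial>\<nu>)"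
    unfolding modulus_def
  proof (intro nn_integral_mono)
    fix s w
    let ?a = "?d (rad h s w)" and ?b = "g (rad h s w) - g (rad 0 s w)" and ?c = "- ?d (rad 0 s w)"
    have "f (rad h s w) - f (rad 0 s w) = ?a + ?b + ?c" by simp
    then show "?n (f (rad h s w) - f (rad 0 s w)) \<le>
      ennreal (3 powr p) * (?n ?a + ?n ?b + ?n (?d (rad 0 s w)))"
      using ennreal_norm_add3_powr_le[of ?a ?b ?c] by (simp only: norm_minus_cancel)
  qed
  also have "\<dots> = ennreal (3 powr p) * ((\<integral>\<^sup>+s. \<integral>\<^sup>+w. ?n (?d (rad h s w)) \<partial>\<mu> \<partial>\<nu>) + modulus h g
      + (\<integral>\<^sup>+s. \<integral>\<^sup>+w. ?n (?d (rad 0 s w)) \<partial>\<mu> \<partial>\<nu>))"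
    unfolding modulus_def by (simp add: nn_integral_cmult nn_integral_add)
  also have "\<dots> = ennreal (3 powr p) * (pint ?d + modulus h g + pint ?d)"
    unfolding pint_def
    using nn_integral_rad[of "\<lambda>x. ?n (?d x)" h] nn_integral_rad[of "\<lambda>x. ?n (?d x)" 0] by simp
  finally show ?thesis by (simp add: ac_simps)
qed

section \<open>Continuity of translation for a single function\<close>

text \<open>
  The norm of a vector changes by at most \<open>\<bar>h\<bar>\<close> when the vector is moved by \<open>(h, 0)\<close>.
\<close>

lemma abs_rad_diff_le:
  assumes "w \<in> {-1..1}"
  shows "\<bar>rad h s w - rad 0 s w\<bar> \<le> \<bar>h\<bar>"
proof -
  have "\<bar>rad h s w - rad 0 s w\<bar> \<le> norm ((h - s * w, s * sqrt (1 - w\<^sup>2)) - (0 - s * w, s * sqrt (1 - w\<^sup>2)))"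
    unfolding rad_eq_norm[OF assms] by (rule norm_triangle_ineq3)
  then show ?thesis by (simp add: norm_Pair)
qed

text \<open>
  Uniform continuity bounds the integrand by a small constant, and the compact support confines it to a
  set whose measure does not depend on \<open>h\<close>, by invariance.
\<close>

lemma modulus_small_continuous:
  fixes k :: "real \<Rightarrow> 'a::{banach, second_countable_topology}"
  assumes cont: "continuous_on UNIV k" and supp: "\<And>x. R < \<bar>x\<bar> \<Longrightarrow> k x = 0" and e: "0 < e"
  shows "\<exists>\<delta>>0. \<forall>h. 0 \<le> h \<and> h \<le> \<delta> \<longrightarrow> modulus h k \<le> ennreal e"
proof -
  define V where "V = measure \<nu> {0..R}"
  have V: "emeasure \<nu> {0..R} = ennreal V"
    unfolding V_def using nu_finite[of R] by (intro emeasure_eq_ennreal_measure) auto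
  have V0: "0 \<le> V" by (simp add: V_def)
  define c where "c = (e / (2 * (V + 1))) powr (1 / p)"
  have c: "0 < c" using e V0 by (simp add: c_def)
  have cp: "c powr p = e / (2 * (V + 1))"
    using p_ge_1 e V0 by (simp add: c_def powr_powr)
  have "uniformly_continuous_on {-R-1..R+1} k"
    by (intro compact_uniformly_continuous continuous_on_subset[OF cont]) auto
  with c obtain \<delta> where \<delta>: "0 < \<delta>" and
    uc: "\<And>x y. x \<in> {-R-1..R+1} \<Longrightarrow> y \<in> {-R-1..R+1} \<Longrightarrow> dist y x < \<delta> \<Longrightarrow> dist (k y) (k x) < c"
    unfolding uniformly_continuous_on_def by metis
  have small: "norm (k a - k b) powr p \<le> c powr p * (indicator {-R..R} a + indicator {-R..R} b)"
    if "\<bar>a - b\<bar> \<le> min (\<delta> / 2) 1" for a b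
  proof (cases "a \<in> {-R..R} \<or> b \<in> {-R..R}")
    case True
    with that \<delta> have "dist (k a) (k b) < c"
      by (intro uc) (auto simp: dist_real_def abs_if split: if_splits)
    then have "norm (k a - k b) powr p \<le> c powr p"
      using p_ge_1 by (intro powr_mono2) (auto simp: dist_norm)
    also have "\<dots> \<le> c powr p * (indicator {-R..R} a + indicator {-R..R} b)"
      using True by (auto simp: indicator_def)
    finally show ?thesis .
  next
    case False
    then have "k a = 0" "k b = 0" using supp[of a] supp[of b] by auto
    then show ?thesis by simp
  qed
  have ind: "(\<integral>\<^sup>+s. \<integral>\<^sup>+w. indicator {-R..R} (rad t s w) \<partial>\<mu> \<partial>\<nu>) = ennreal V" for t
  proof -
    have "(\<integral>\<^sup>+s. \<integral>\<^sup>+w. indicator {-R..R} (rad t s w) \<partial>\<mu> \<partial>\<nu>) = (\<integral>\<^sup>+s. indicator {-R..R} s \<partial>\<nu>)"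
      by (rule nn_integral_rad) measurable
    also have "\<dots> = (\<integral>\<^sup>+s. indicator {0..R} s \<partial>\<nu>)"
      by (intro nn_integral_cong_AE eventually_mono[OF AE_nu]) (auto simp: indicator_def)
    finally show ?thesis by (simp add: V)
  qed
  show ?thesis
  proof (intro exI[of _ "min (\<delta> / 2) 1"] conjI allI impI)
    fix h assume h: "0 \<le> h \<and> h \<le> min (\<delta> / 2) 1"
    have pointwise: "ennreal (norm (k (rad h s w) - k (rad 0 s w)) powr p)
        \<le> ennreal (c powr p) * (indicator {-R..R} (rad h s w) + indicator {-R..R} (rad 0 s w))"
      if w: "w \<in> {-1..1}" for s w
    proof -
      have "norm (k (rad h s w) - k (rad 0 s w)) powr p
          \<le> c powr p * (indicator {-R..R} (rad h s w) + indicator {-R..R} (rad 0 s w))"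
        using abs_rad_diff_le[OF w, of h s] h by (intro small) auto
      then have "ennreal (norm (k (rad h s w) - k (rad 0 s w)) powr p)
          \<le> ennreal (c powr p * (indicator {-R..R} (rad h s w) + indicator {-R..R} (rad 0 s w)))"
        by (rule ennreal_leI)
      then show ?thesis
        by (simp add: ennreal_mult ennreal_plus ennreal_indicator)
    qed
    have "modulus h k \<le> (\<integral>\<^sup>+s. \<integral>\<^sup>+w. ennreal (c powr p) *
        (indicator {-R..R} (rad h s w) + indicator {-R..R} (rad 0 s w)) \<partial>\<mu> \<partial>\<nu>)"
      unfolding modulus_def
      by (intro nn_integral_mono nn_integral_mono_AE eventually_mono[OF AE_mu] pointwise)
    also have "\<dots> = ennreal (c powr p) * (ennreal V + ennreal V)"
      by (simp add: nn_integral_cmult nn_integral_add ind)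
    also have "\<dots> = ennreal (c powr p * (V + V))"
      using V0 by (simp only: ennreal_mult ennreal_plus powr_ge_zero add_nonneg_nonneg)
    also have "\<dots> \<le> ennreal e"
    proof (rule ennreal_leI)
      have "e / (2 * (V + 1)) * (V + V) = e * (V / (V + 1))"
        using V0 by (simp add: field_simps)
      also have "\<dots> \<le> e * 1"
        using V0 e by (intro mult_left_mono) auto
      finally show "c powr p * (V + V) \<le> e" by (simp add: cp)
    qed
    finally show "modulus h k \<le> ennreal e" .
  qed (use \<delta> in auto)
qed

lemma pint_dominated_convergence:
  fixes u :: "nat \<Rightarrow> real \<Rightarrow> 'a::{banach, second_countable_topology}"
  assumes [measurable]: "\<And>n. u n \<in> borel_measurable borel" "b \<in> borel_measurable borel"
    and lim: "AE s in \<nu>. (\<lambda>n. u n s) \<longlonglongrightarrow> 0"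
    and le: "\<And>n. AE s in \<nu>. ennreal (norm (u n s) powr p) \<le> b s"
    and fin: "(\<integral>\<^sup>+s. b s \<partial>\<nu>) < \<infinity>"
  shows "(\<lambda>n. pint (u n)) \<longlonglongrightarrow> 0"
proof -
  have "(\<lambda>n. pint (u n)) \<longlonglongrightarrow> (\<integral>\<^sup>+s. 0 \<partial>\<nu>)"
    unfolding pint_def
  proof (rule nn_integral_dominated_convergence[where w = b])
    show "AE s in \<nu>. (\<lambda>n. ennreal (norm (u n s) powr p)) \<longlonglongrightarrow> 0"
      using lim
    proof eventually_elim
      case (elim s)
      have "(\<lambda>n. norm (u n s) powr p) \<longlonglongrightarrow> 0"
        using p_ge_1 by (intro tendsto_zero_powrI[OF tendsto_norm_zero[OF elim] tendsto_const]) auto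
      then show ?case using tendsto_ennrealI by fastforce
    qed
  qed (use le fin in auto)
  then show ?thesis by simp
qed

lemma pint_ex_truncation:
  fixes f :: "real \<Rightarrow> 'a::{banach, second_countable_topology}"
  assumes [measurable]: "f \<in> borel_measurable borel" and fin: "pint f < \<infinity>" and e: "0 < e"
  shows "\<exists>n::nat. pint (\<lambda>x. f x - (if \<bar>x\<bar> \<le> n \<and> norm (f x) \<le> n then f x else 0)) < ennreal e"
proof -
  let ?u = "\<lambda>n x. f x - (if \<bar>x\<bar> \<le> real n \<and> norm (f x) \<le> real n then f x else 0)"
  have "(\<lambda>n. pint (?u n)) \<longlonglongrightarrow> 0"
  proof (rule pint_dominated_convergence[where b = "\<lambda>s. ennreal (norm (f s) powr p)"])
    show "AE s in \<nu>. (\<lambda>n. ?u n s) \<longlonglongrightarrow> 0"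
    proof (intro AE_I2 tendsto_eventually)
      fix s
      obtain N :: nat where "max \<bar>s\<bar> (norm (f s)) \<le> N" using real_arch_simple by blast
      then have "\<forall>n\<ge>N. ?u n s = 0" by auto
      then show "\<forall>\<^sub>F n in sequentially. ?u n s = 0"
        unfolding eventually_sequentially by blast
    qed
  qed (use fin in \<open>auto simp: pint_def[symmetric]\<close>)
  then have "\<forall>\<^sub>F n in sequentially. pint (?u n) < ennreal e"
    using e by (intro order_tendstoD) auto
  then show ?thesis
    by (auto simp: eventually_sequentially)
qed

text \<open>
  A Lebesgue measurable function is an almost everywhere limit of continuous ones. Retracting their
  values to the ball of radius \<open>b\<close> and cutting them off continuously outside \<open>[-b, b]\<close> leaves the limit
  unchanged and provides a dominating function.
\<close>

lemma pint_ex_continuous_approx_bounded: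
  fixes f :: "real \<Rightarrow> 'a::euclidean_space"
  assumes [measurable]: "f \<in> borel_measurable borel"
    and supp: "\<And>x. b < \<bar>x\<bar> \<Longrightarrow> f x = 0" and bnd: "\<And>x. norm (f x) \<le> b" and e: "0 < e"
  shows "\<exists>k. continuous_on UNIV k \<and> (\<forall>x. b + 1 < \<bar>x\<bar> \<longrightarrow> k x = 0) \<and> pint (\<lambda>x. f x - k x) < ennreal e"
proof -
  have b: "0 \<le> b" using bnd[of 0] norm_ge_zero order_trans by blast
  have "f measurable_on UNIV"
    by (intro lebesgue_measurable_imp_measurable_on measurable_completion) auto
  then obtain N g where N: "negligible N" and g: "\<And>n. continuous_on UNIV (g n)"
    and lim: "\<And>x. x \<notin> N \<Longrightarrow> (\<lambda>n. g n x) \<longlonglongrightarrow> f x"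
    unfolding measurable_on_def by auto
  define clip where "clip = closest_point (cball (0::'a) b)"
  have clip_cont: "continuous_on UNIV clip"
    unfolding clip_def using b by (intro continuous_on_closest_point) auto
  have clip_le: "norm (clip v) \<le> b" for v
    using closest_point_in_set[of "cball 0 b" v] b by (auto simp: clip_def)
  have clip_id: "clip v = v" if "norm v \<le> b" for v
    using that by (simp add: clip_def closest_point_self)
  define cut :: "real \<Rightarrow> real" where "cut x = max 0 (min 1 (b + 1 - \<bar>x\<bar>))" for x
  have cut: "0 \<le> cut x" "cut x \<le> 1" "b + 1 < \<bar>x\<bar> \<Longrightarrow> cut x = 0" "\<bar>x\<bar> \<le> b \<Longrightarrow> cut x = 1" for x
    by (auto simp: cut_def)
  have cut_f: "cut x *\<^sub>R clip (f x) = f x" for x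
    using cut(4)[of x] supp[of x] clip_id[OF bnd[of x]] by (cases "\<bar>x\<bar> \<le> b") auto
  define k where "k n x = cut x *\<^sub>R clip (g n x)" for n x
  have k_cont: "continuous_on UNIV (k n)" for n
    unfolding k_def cut_def
    by (intro continuous_intros continuous_on_compose2[OF clip_cont g]) auto
  then have [measurable]: "k n \<in> borel_measurable borel" for n
    by (rule borel_measurable_continuous_onI)
  have "(\<lambda>n. pint (\<lambda>x. f x - k n x)) \<longlonglongrightarrow> 0"
  proof (rule pint_dominated_convergence[where b = "\<lambda>x. ennreal ((2 * b) powr p) * indicator {-b-1..b+1} x"])
    have "AE x in lborel. x \<notin> N"
      using N by (metis AE_completion_iff AE_not_in negligible_iff_null_sets)
    then have "AE x in \<nu>. x \<notin> N" by (rule AE_nu_if_AE_lborel)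
    then show "AE x in \<nu>. (\<lambda>n. f x - k n x) \<longlonglongrightarrow> 0"
    proof eventually_elim
      case (elim x)
      have "(\<lambda>n. k n x) \<longlonglongrightarrow> cut x *\<^sub>R clip (f x)"
        unfolding k_def
        by (intro tendsto_intros continuous_on_tendsto_compose[OF clip_cont lim[OF elim]]) auto
      then have "(\<lambda>n. f x - k n x) \<longlonglongrightarrow> f x - f x"
        unfolding cut_f by (intro tendsto_intros)
      then show ?case by simp
    qed
    have "norm (f x - k n x) powr p \<le> (2 * b) powr p * indicator {-b-1..b+1} x" for x n
    proof (cases "x \<in> {-b-1..b+1}")
      case True
      have "norm (k n x) \<le> 1 * b"
        unfolding k_def norm_scaleR using cut[of x] clip_le b by (intro mult_mono) auto
      then have "norm (f x - k n x) \<le> 2 * b"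
        using bnd[of x] norm_triangle_ineq4[of "f x" "k n x"] by linarith
      then show ?thesis using True p_ge_1 by (simp add: powr_mono2)
    next
      case False
      then have "f x = 0" "k n x = 0"
        using supp[of x] cut(3)[of x] by (auto simp: k_def)
      then show ?thesis using False by simp
    qed
    then have "ennreal (norm (f x - k n x) powr p) \<le> ennreal ((2 * b) powr p * indicator {-b-1..b+1} x)" for x n
      by (rule ennreal_leI)
    then show "AE x in \<nu>. ennreal (norm (f x - k n x) powr p) \<le> ennreal ((2 * b) powr p) * indicator {-b-1..b+1} x" for n
      by (intro AE_I2) (simp add: ennreal_mult ennreal_indicator)
    have "(\<integral>\<^sup>+x. ennreal ((2 * b) powr p) * indicator {-b-1..b+1} x \<partial>\<nu>)
        = (\<integral>\<^sup>+x. ennreal ((2 * b) powr p) * indicator {0..b+1} x \<partial>\<nu>)"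
      by (intro nn_integral_cong_AE eventually_mono[OF AE_nu]) (auto simp: indicator_def b)
    also have "\<dots> = ennreal ((2 * b) powr p) * emeasure \<nu> {0..b+1}"
      by (rule nn_integral_cmult_indicator) simp
    also have "\<dots> < \<infinity>"
      using nu_finite[of "b + 1"] by (simp add: ennreal_mult_less_top)
    finally show "(\<integral>\<^sup>+x. ennreal ((2 * b) powr p) * indicator {-b-1..b+1} x \<partial>\<nu>) < \<infinity>" .
  qed simp_all
  then have "\<forall>\<^sub>F n in sequentially. pint (\<lambda>x. f x - k n x) < ennreal e"
    using e by (intro order_tendstoD) auto
  then obtain n where "pint (\<lambda>x. f x - k n x) < ennreal e"
    by (auto simp: eventually_sequentially)
  moreover have "\<forall>x. b + 1 < \<bar>x\<bar> \<longrightarrow> k n x = 0"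
    using cut(3) by (simp add: k_def)
  ultimately show ?thesis using k_cont by blast
qed

lemma pint_add_le:
  fixes f g :: "real \<Rightarrow> 'a::{banach, second_countable_topology}"
  assumes [measurable]: "f \<in> borel_measurable borel" "g \<in> borel_measurable borel"
  shows "pint (\<lambda>x. f x + g x) \<le> ennreal (3 powr p) * (pint f + pint g)"
proof -
  have "pint (\<lambda>x. f x + g x) \<le> (\<integral>\<^sup>+s. ennreal (3 powr p) *
      (ennreal (norm (f s) powr p) + ennreal (norm (g s) powr p)) \<partial>\<nu>)"
    unfolding pint_def
  proof (rule nn_integral_mono)
    show "ennreal (norm (f s + g s) powr p) \<le>
      ennreal (3 powr p) * (ennreal (norm (f s) powr p) + ennreal (norm (g s) powr p))" for s
      using ennreal_norm_add3_powr_le[of "f s" "g s" 0] by simp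
  qed
  also have "\<dots> = ennreal (3 powr p) * (pint f + pint g)"
    unfolding pint_def by (simp add: nn_integral_cmult nn_integral_add)
  finally show ?thesis .
qed

lemma pint_ex_continuous_approx:
  fixes f :: "real \<Rightarrow> 'a::euclidean_space"
  assumes [measurable]: "f \<in> borel_measurable borel" and fin: "pint f < \<infinity>" and e: "0 < e"
  shows "\<exists>k R. continuous_on UNIV k \<and> (\<forall>x. R < \<bar>x\<bar> \<longrightarrow> k x = 0) \<and> pint (\<lambda>x. f x - k x) \<le> ennreal e"
proof -
  define c where "c = 3 powr p"
  define d where "d = e / (2 * c)"
  have c: "0 < c" by (simp add: c_def)
  have d: "0 < d" using e c by (simp add: d_def)
  obtain n :: nat where n: "pint (\<lambda>x. f x - (if \<bar>x\<bar> \<le> n \<and> norm (f x) \<le> n then f x else 0)) < ennreal d"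
    using pint_ex_truncation[OF assms(1,2) d] by blast
  define g where "g x = (if \<bar>x\<bar> \<le> real n \<and> norm (f x) \<le> real n then f x else 0)" for x
  have [measurable]: "g \<in> borel_measurable borel" unfolding g_def by measurable
  have g_supp: "g x = 0" if "real n < \<bar>x\<bar>" for x using that by (simp add: g_def)
  have g_bnd: "norm (g x) \<le> real n" for x by (simp add: g_def)
  obtain k where k: "continuous_on UNIV k" "\<forall>x. real n + 1 < \<bar>x\<bar> \<longrightarrow> k x = 0"
    and gk: "pint (\<lambda>x. g x - k x) < ennreal d"
    using pint_ex_continuous_approx_bounded[of g "real n" d] g_supp g_bnd d by auto
  have [measurable]: "k \<in> borel_measurable borel"
    using k(1) by (rule borel_measurable_continuous_onI)
  have "pint (\<lambda>x. f x - k x) = pint (\<lambda>x. (f x - g x) + (g x - k x))" by simp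
  also have "\<dots> \<le> ennreal c * (pint (\<lambda>x. f x - g x) + pint (\<lambda>x. g x - k x))"
    unfolding c_def by (rule pint_add_le) measurable
  also have "\<dots> \<le> ennreal c * (ennreal d + ennreal d)"
    using n gk unfolding g_def[symmetric] by (intro mult_left_mono add_mono) auto
  also have "\<dots> = ennreal (c * (d + d))"
    using c d by (simp only: ennreal_mult ennreal_plus less_imp_le add_nonneg_nonneg)
  also have "c * (d + d) = e" using c by (simp add: d_def field_simps)
  finally show ?thesis using k by blast
qed

lemma modulus_tendsto_0:
  fixes f :: "real \<Rightarrow> 'a::euclidean_space"
  assumes [measurable]: "f \<in> borel_measurable borel" and fin: "pint f < \<infinity>" and e: "0 < e"
  shows "\<exists>\<delta>>0. \<forall>h. 0 \<le> h \<and> h \<le> \<delta> \<longrightarrow> modulus h f \<le> ennreal e"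
proof -
  define c where "c = 3 powr p"
  define d where "d = e / (3 * c)"
  have c: "0 < c" by (simp add: c_def)
  have d: "0 < d" using e c by (simp add: d_def)
  obtain k R where k: "continuous_on UNIV k" "\<And>x. R < \<bar>x\<bar> \<Longrightarrow> k x = 0"
    and fk: "pint (\<lambda>x. f x - k x) \<le> ennreal d"
    using pint_ex_continuous_approx[OF assms(1,2) d] by blast
  have [measurable]: "k \<in> borel_measurable borel"
    using k(1) by (rule borel_measurable_continuous_onI)
  obtain \<delta> where \<delta>: "\<delta> > 0" and small: "\<And>h. 0 \<le> h \<Longrightarrow> h \<le> \<delta> \<Longrightarrow> modulus h k \<le> ennreal d"
    using modulus_small_continuous[OF k d] by blast
  show ?thesis
  proof (intro exI[of _ \<delta>] conjI allI impI)
    fix h assume h: "0 \<le> h \<and> h \<le> \<delta>"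
    have "modulus h f \<le> ennreal c * (pint (\<lambda>x. f x - k x) + pint (\<lambda>x. f x - k x) + modulus h k)"
      unfolding c_def by (rule modulus_le_modulus_add) measurable
    also have "\<dots> \<le> ennreal c * (ennreal d + ennreal d + ennreal d)"
      using fk small[of h] h by (intro mult_left_mono add_mono) auto
    also have "\<dots> = ennreal (c * (d + d + d))"
      using c d by (simp only: ennreal_mult ennreal_plus less_imp_le add_nonneg_nonneg)
    also have "c * (d + d + d) = e" using c by (simp add: d_def field_simps)
    finally show "modulus h f \<le> ennreal e" .
  qed fact
qed

section \<open>Averages of translates\<close>

text \<open>
  The mean over \<open>[0, \<delta>]\<close> with respect to \<open>\<nu>\<close>, so that the symmetry in \<open>t\<close> and \<open>s\<close> leads back to \<open>pint\<close>.
\<close>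

definition average :: "real \<Rightarrow> (real \<Rightarrow> 'a::{banach, second_countable_topology}) \<Rightarrow> real \<Rightarrow> 'a" where
  "average \<delta> f s = (\<integral>t. translate t f s \<partial>uniform_measure \<nu> {0..\<delta>})"

lemma prob_space_uniform_nu:
  assumes "0 < \<delta>"
  shows "prob_space (uniform_measure \<nu> {0..\<delta>})"
  using nu_pos[OF assms] nu_finite[of \<delta>] by (intro prob_space_uniform_measure) auto

lemma nn_integral_uniform_nu_le:
  assumes [measurable]: "g \<in> borel_measurable borel"
  shows "(\<integral>\<^sup>+t. g t \<partial>uniform_measure \<nu> {0..\<delta>}) \<le> (\<integral>\<^sup>+t. g t \<partial>\<nu>) / emeasure \<nu> {0..\<delta>}"
  by (subst nn_integral_uniform_measure)
    (auto intro!: divide_right_mono_ennreal nn_integral_mono simp: indicator_def)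

text \<open>
  By symmetry the integrand is the function \<open>T\<^sub>s f\<close>, which lies in \<open>L\<^sub>p\<close> because translation is a
  contraction. So the average is a genuine integral at every point \<open>s\<close>, not just almost everywhere.
\<close>

lemma integrable_translate_uniform:
  fixes f :: "real \<Rightarrow> 'a::{banach, second_countable_topology}"
  assumes [measurable]: "f \<in> borel_measurable borel" and fin: "pint f < \<infinity>" and d: "0 < \<delta>"
  shows "integrable (uniform_measure \<nu> {0..\<delta>}) (\<lambda>t. translate t f s)"
proof -
  interpret U: prob_space "uniform_measure \<nu> {0..\<delta>}" by (rule prob_space_uniform_nu[OF d])
  show ?thesis
  proof (rule U.integrable_if_powr_integral_finite[OF _ p_ge_1])
    have "(\<integral>\<^sup>+t. ennreal (norm (translate t f s) powr p) \<partial>uniform_measure \<nu> {0..\<delta>})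
        \<le> pint (translate s f) / emeasure \<nu> {0..\<delta>}"
      unfolding translate_commute[of _ f s] pint_def by (rule nn_integral_uniform_nu_le) measurable
    also have "\<dots> \<le> pint f / emeasure \<nu> {0..\<delta>}"
      by (intro divide_right_mono_ennreal pint_translate_le) measurable
    also have "\<dots> < \<infinity>"
      using fin nu_pos[OF d] by (simp add: ennreal_divide_eq_top_iff less_top[symmetric] zero_less_iff_neq_zero)
    finally show "(\<integral>\<^sup>+t. ennreal (norm (translate t f s) powr p) \<partial>uniform_measure \<nu> {0..\<delta>}) < \<infinity>" .
  qed measurable
qed

lemma norm_average_powr_le:
  fixes f :: "real \<Rightarrow> 'a::{banach, second_countable_topology}"
  assumes [measurable]: "f \<in> borel_measurable borel" and d: "0 < \<delta>"
  shows "ennreal (norm (average \<delta> f s) powr p) \<le> pint f / emeasure \<nu> {0..\<delta>}"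
proof -
  interpret U: prob_space "uniform_measure \<nu> {0..\<delta>}" by (rule prob_space_uniform_nu[OF d])
  have "ennreal (norm (average \<delta> f s) powr p)
      \<le> (\<integral>\<^sup>+t. ennreal (norm (translate t f s) powr p) \<partial>uniform_measure \<nu> {0..\<delta>})"
    unfolding average_def by (rule U.norm_integral_powr_le[OF _ p_ge_1]) measurable
  also have "\<dots> \<le> pint (translate s f) / emeasure \<nu> {0..\<delta>}"
    unfolding translate_commute[of _ f s] pint_def by (rule nn_integral_uniform_nu_le) measurable
  also have "\<dots> \<le> pint f / emeasure \<nu> {0..\<delta>}"
    by (intro divide_right_mono_ennreal pint_translate_le) measurable
  finally show ?thesis .
qed

text \<open>
  Symmetry exchanges the evaluation points \<open>s\<close>, \<open>s'\<close> with the translation parameters. This is the step from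
  equicontinuity in \<open>L\<^sub>p\<close> to pointwise equicontinuity.
\<close>

lemma norm_average_diff_powr_le:
  fixes f :: "real \<Rightarrow> 'a::{banach, second_countable_topology}"
  assumes [measurable]: "f \<in> borel_measurable borel" and fin: "pint f < \<infinity>" and d: "0 < \<delta>"
  shows "ennreal (norm (average \<delta> f s - average \<delta> f s') powr p)
    \<le> pint (\<lambda>t. translate s f t - translate s' f t) / emeasure \<nu> {0..\<delta>}"
proof -
  interpret U: prob_space "uniform_measure \<nu> {0..\<delta>}" by (rule prob_space_uniform_nu[OF d])
  have "average \<delta> f s - average \<delta> f s' = (\<integral>t. translate t f s - translate t f s' \<partial>uniform_measure \<nu> {0..\<delta>})"
    unfolding average_def
    by (rule Bochner_Integration.integral_diff[symmetric]; rule integrable_translate_uniform[OF assms])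
  then have "ennreal (norm (average \<delta> f s - average \<delta> f s') powr p)
      \<le> (\<integral>\<^sup>+t. ennreal (norm (translate t f s - translate t f s') powr p) \<partial>uniform_measure \<nu> {0..\<delta>})"
    by (simp only:) (rule U.norm_integral_powr_le[OF _ p_ge_1], measurable)
  also have "\<dots> \<le> pint (\<lambda>t. translate s f t - translate s' f t) / emeasure \<nu> {0..\<delta>}"
    unfolding translate_commute[of _ f s] translate_commute[of _ f s'] pint_def
    by (rule nn_integral_uniform_nu_le) measurable
  finally show ?thesis .
qed

lemma average_measurable [measurable]:
  fixes f :: "real \<Rightarrow> 'a::{banach, second_countable_topology}"
  assumes [measurable]: "f \<in> borel_measurable borel" and d: "0 < \<delta>"
  shows "average \<delta> f \<in> borel_measurable borel"
proof -
  interpret U: prob_space "uniform_measure \<nu> {0..\<delta>}" by (rule prob_space_uniform_nu[OF d])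
  have [measurable_cong]: "sets (uniform_measure \<nu> {0..\<delta>}) = sets borel" by (simp add: sets_nu)
  have "(\<lambda>s. \<integral>t. translate t f s \<partial>uniform_measure \<nu> {0..\<delta>}) \<in> borel_measurable borel" by measurable
  then show ?thesis by (simp add: average_def[abs_def])
qed

text \<open>
  Jensen's inequality for the mean over \<open>t\<close>, followed by Tonelli.
\<close>

lemma pint_average_diff_le:
  fixes f :: "real \<Rightarrow> 'a::{banach, second_countable_topology}"
  assumes [measurable]: "f \<in> borel_measurable borel" and fin: "pint f < \<infinity>" and d: "0 < \<delta>"
    and le: "\<And>t. t \<in> {0..\<delta>} \<Longrightarrow> pint (\<lambda>s. translate t f s - f s) \<le> e"
  shows "pint (\<lambda>s. average \<delta> f s - f s) \<le> e"
proof -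
  let ?U = "uniform_measure \<nu> {0..\<delta>}"
  interpret U: prob_space ?U by (rule prob_space_uniform_nu[OF d])
  interpret nu_U: pair_sigma_finite \<nu> ?U ..
  have [measurable_cong]: "sets ?U = sets borel" by (simp add: sets_nu)
  have avg: "average \<delta> f s - f s = (\<integral>t. translate t f s - f s \<partial>?U)" for s
    unfolding average_def
    using U.prob_space
    by (subst Bochner_Integration.integral_diff) (simp_all add: integrable_translate_uniform[OF assms(1) fin d])
  have "pint (\<lambda>s. average \<delta> f s - f s) \<le> (\<integral>\<^sup>+s. \<integral>\<^sup>+t. ennreal (norm (translate t f s - f s) powr p) \<partial>?U \<partial>\<nu>)"
    unfolding pint_def avg
    by (intro nn_integral_mono U.norm_integral_powr_le p_ge_1) measurable
  also have "\<dots> = (\<integral>\<^sup>+t. pint (\<lambda>s. translate t f s - f s) \<partial>?U)"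
    unfolding pint_def by (rule nu_U.Fubini'[symmetric]) measurable
  also have "\<dots> \<le> (\<integral>\<^sup>+t. e \<partial>?U)"
  proof (rule nn_integral_mono_AE)
    have "AE t in ?U. t \<in> {0..\<delta>}"
      using nu_finite[of \<delta>] nu_pos[OF d] by (intro AE_uniform_measureI) auto
    then show "AE t in ?U. pint (\<lambda>s. translate t f s - f s) \<le> e"
      by eventually_elim (rule le)
  qed
  also have "\<dots> = e" by (simp only: nn_integral_const U.emeasure_space_1 mult_1_right)
  finally show ?thesis .
qed

section \<open>Compactness in terms of translations\<close>

text \<open>
  The three notions of the theorem in terms of \<open>p\<close>-th powers of norms, for Borel functions.
\<close>

definition totally_bounded :: "(real \<Rightarrow> 'a::{banach, second_countable_topology}) set \<Rightarrow> bool" where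
  "totally_bounded K \<longleftrightarrow> (\<forall>\<epsilon>::real>0. \<exists>F. finite F \<and> F \<subseteq> K \<and>
     (\<forall>f\<in>K. \<exists>g\<in>F. pint (\<lambda>x. g x - f x) < ennreal \<epsilon>))"

definition equi_vanishing :: "(real \<Rightarrow> 'a::{banach, second_countable_topology}) set \<Rightarrow> bool" where
  "equi_vanishing K \<longleftrightarrow> (\<forall>\<epsilon>::real>0. \<exists>R>0. \<forall>f\<in>K.
     (\<integral>\<^sup>+x. ennreal (norm (f x) powr p) * indicator {R..} x \<partial>\<nu>) < ennreal \<epsilon>)"

definition equi_continuous :: "(real \<Rightarrow> 'a::{banach, second_countable_topology}) set \<Rightarrow> bool" where
  "equi_continuous K \<longleftrightarrow> (\<forall>\<epsilon>::real>0. \<forall>M>0. \<exists>\<delta>>0. \<forall>h. 0 \<le> h \<and> h \<le> \<delta> \<longrightarrow>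
     (\<forall>f\<in>K. \<forall>t\<in>{0..M}. pint (\<lambda>s. translate (t + h) f s - translate t f s) < ennreal \<epsilon>))"

lemma pint_tail_le:
  fixes f g :: "real \<Rightarrow> 'a::{banach, second_countable_topology}"
  assumes [measurable]: "f \<in> borel_measurable borel" "g \<in> borel_measurable borel" "A \<in> sets borel"
  shows "(\<integral>\<^sup>+x. ennreal (norm (f x + g x) powr p) * indicator A x \<partial>\<nu>) \<le> ennreal (3 powr p) *
    ((\<integral>\<^sup>+x. ennreal (norm (f x) powr p) * indicator A x \<partial>\<nu>) + (\<integral>\<^sup>+x. ennreal (norm (g x) powr p) * indicator A x \<partial>\<nu>))"
proof -
  have eq: "pint (\<lambda>x. indicator A x *\<^sub>R u x) = (\<integral>\<^sup>+x. ennreal (norm (u x) powr p) * indicator A x \<partial>\<nu>)"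
    for u :: "real \<Rightarrow> 'a"
    unfolding pint_def by (intro nn_integral_cong) (simp add: indicator_def)
  have "pint (\<lambda>x. indicator A x *\<^sub>R (f x + g x)) = pint (\<lambda>x. indicator A x *\<^sub>R f x + indicator A x *\<^sub>R g x)"
    by (simp add: scaleR_add_right)
  also have "\<dots> \<le> ennreal (3 powr p) * (pint (\<lambda>x. indicator A x *\<^sub>R f x) + pint (\<lambda>x. indicator A x *\<^sub>R g x))"
    by (rule pint_add_le) measurable
  finally show ?thesis unfolding eq .
qed

lemma pint_tail_small:
  fixes f :: "real \<Rightarrow> 'a::{banach, second_countable_topology}"
  assumes [measurable]: "f \<in> borel_measurable borel" and fin: "pint f < \<infinity>" and e: "0 < e"
  shows "\<exists>n::nat. (\<integral>\<^sup>+x. ennreal (norm (f x) powr p) * indicator {real n..} x \<partial>\<nu>) < ennreal e"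
proof -
  have "(\<lambda>n. pint (\<lambda>x. indicator {real n..} x *\<^sub>R f x)) \<longlonglongrightarrow> 0"
  proof (rule pint_dominated_convergence[where b = "\<lambda>s. ennreal (norm (f s) powr p)"])
    show "AE s in \<nu>. (\<lambda>n. indicator {real n..} s *\<^sub>R f s) \<longlonglongrightarrow> 0"
    proof (intro AE_I2 tendsto_eventually)
      fix s :: real
      obtain N :: nat where "s < N" using reals_Archimedean2 by blast
      then have "\<forall>n\<ge>N. indicator {real n..} s *\<^sub>R f s = 0" by (auto simp: indicator_def)
      then show "\<forall>\<^sub>F n in sequentially. indicator {real n..} s *\<^sub>R f s = 0"
        unfolding eventually_sequentially by blast
    qed
  qed (use fin in \<open>auto simp: pint_def[symmetric] indicator_def\<close>)
  then have "\<forall>\<^sub>F n in sequentially. pint (\<lambda>x. indicator {real n..} x *\<^sub>R f x) < ennreal e"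
    using e by (intro order_tendstoD) auto
  then obtain n where "pint (\<lambda>x. indicator {real n..} x *\<^sub>R f x) < ennreal e"
    by (auto simp: eventually_sequentially)
  also have "pint (\<lambda>x. indicator {real n..} x *\<^sub>R f x) = (\<integral>\<^sup>+x. ennreal (norm (f x) powr p) * indicator {real n..} x \<partial>\<nu>)"
    unfolding pint_def by (intro nn_integral_cong) (simp add: indicator_def)
  finally show ?thesis by blast
qed

lemma pint_minus_commute: "pint (\<lambda>x. f x - g x) = pint (\<lambda>x. g x - f x)"
  unfolding pint_def by (simp add: norm_minus_commute)

lemma totally_bounded_imp_equi_vanishing:
  fixes K :: "(real \<Rightarrow> 'a::{banach, second_countable_topology}) set"
  assumes K: "\<And>f. f \<in> K \<Longrightarrow> f \<in> borel_measurable borel" "\<And>f. f \<in> K \<Longrightarrow> pint f < \<infinity>"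
    and tb: "totally_bounded K"
  shows "equi_vanishing K"
  unfolding equi_vanishing_def
proof (intro allI impI)
  fix e :: real assume e: "0 < e"
  define c where "c = 3 powr p"
  define d where "d = e / (2 * c)"
  have c: "0 < c" by (simp add: c_def)
  have d: "0 < d" using e c by (simp add: d_def)
  obtain F where F: "finite F" "F \<subseteq> K" "\<And>f. f \<in> K \<Longrightarrow> \<exists>g\<in>F. pint (\<lambda>x. g x - f x) < ennreal d"
    using tb d unfolding totally_bounded_def by meson
  have "\<forall>g\<in>F. \<exists>n::nat. (\<integral>\<^sup>+x. ennreal (norm (g x) powr p) * indicator {real n..} x \<partial>\<nu>) < ennreal d"
    using F(2) K d by (intro ballI pint_tail_small) auto
  then obtain N where N: "\<And>g. g \<in> F \<Longrightarrow> (\<integral>\<^sup>+x. ennreal (norm (g x) powr p) * indicator {real (N g)..} x \<partial>\<nu>) < ennreal d"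
    by metis
  \<comment> \<open>the successor makes \<open>R\<close> positive\<close>
  define R where "R = real (Suc (Max (N ` F)))"
  show "\<exists>R>0. \<forall>f\<in>K. (\<integral>\<^sup>+x. ennreal (norm (f x) powr p) * indicator {R..} x \<partial>\<nu>) < ennreal e"
  proof (intro exI[of _ R] conjI ballI)
    show "0 < R" by (simp add: R_def)
    fix f assume f: "f \<in> K"
    obtain g where g: "g \<in> F" "pint (\<lambda>x. g x - f x) < ennreal d" using F(3)[OF f] by blast
    have [measurable]: "f \<in> borel_measurable borel" "g \<in> borel_measurable borel"
      using f g F(2) K by auto
    have "N g \<le> Max (N ` F)" using F(1) g(1) by simp
    then have R: "real (N g) \<le> R" by (simp add: R_def)
    have "(\<integral>\<^sup>+x. ennreal (norm (g x) powr p) * indicator {R..} x \<partial>\<nu>)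
        \<le> (\<integral>\<^sup>+x. ennreal (norm (g x) powr p) * indicator {real (N g)..} x \<partial>\<nu>)"
      using R by (intro nn_integral_mono mult_left_mono) (auto simp: indicator_def)
    also have "\<dots> < ennreal d" by (rule N[OF g(1)])
    finally have tail_g: "(\<integral>\<^sup>+x. ennreal (norm (g x) powr p) * indicator {R..} x \<partial>\<nu>) < ennreal d" .
    have "(\<integral>\<^sup>+x. ennreal (norm (f x - g x) powr p) * indicator {R..} x \<partial>\<nu>) \<le> pint (\<lambda>x. f x - g x)"
      unfolding pint_def by (intro nn_integral_mono) (auto simp: indicator_def)
    also have "\<dots> < ennreal d" using g(2) by (subst pint_minus_commute) simp
    finally have tail_d: "(\<integral>\<^sup>+x. ennreal (norm (f x - g x) powr p) * indicator {R..} x \<partial>\<nu>) < ennreal d" .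
    have "(\<integral>\<^sup>+x. ennreal (norm (f x) powr p) * indicator {R..} x \<partial>\<nu>)
        = (\<integral>\<^sup>+x. ennreal (norm ((f x - g x) + g x) powr p) * indicator {R..} x \<partial>\<nu>)" by simp
    also have "\<dots> \<le> ennreal c * ((\<integral>\<^sup>+x. ennreal (norm (f x - g x) powr p) * indicator {R..} x \<partial>\<nu>)
          + (\<integral>\<^sup>+x. ennreal (norm (g x) powr p) * indicator {R..} x \<partial>\<nu>))"
      unfolding c_def by (rule pint_tail_le) measurable
    also have "\<dots> < ennreal c * (ennreal d + ennreal d)"
      using tail_g tail_d c by (intro ennreal_mult_strict_left_mono add_strict_mono) auto
    also have "\<dots> = ennreal (c * (d + d))"
      using c d by (simp only: ennreal_mult ennreal_plus less_imp_le add_nonneg_nonneg)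
    also have "c * (d + d) = e" using c by (simp add: d_def field_simps)
    finally show "(\<integral>\<^sup>+x. ennreal (norm (f x) powr p) * indicator {R..} x \<partial>\<nu>) < ennreal e" .
  qed
qed

lemma totally_bounded_imp_equi_continuous:
  fixes K :: "(real \<Rightarrow> 'a::euclidean_space) set"
  assumes K: "\<And>f. f \<in> K \<Longrightarrow> f \<in> borel_measurable borel" "\<And>f. f \<in> K \<Longrightarrow> pint f < \<infinity>"
    and tb: "totally_bounded K"
  shows "equi_continuous K"
  unfolding equi_continuous_def
proof (intro allI impI)
  fix e M :: real assume e: "0 < e"
  define c where "c = 3 powr p"
  \<comment> \<open>three contributions of \<open>c d\<close>, hence 4 for a strict inequality\<close>
  define d where "d = e / (4 * c)"
  have c: "0 < c" by (simp add: c_def)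
  have d: "0 < d" using e c by (simp add: d_def)
  obtain F where F: "finite F" "F \<subseteq> K" "\<And>f. f \<in> K \<Longrightarrow> \<exists>g\<in>F. pint (\<lambda>x. g x - f x) < ennreal d"
    using tb d unfolding totally_bounded_def by meson
  have "\<forall>g\<in>F. \<exists>\<delta>>0. \<forall>h. 0 \<le> h \<and> h \<le> \<delta> \<longrightarrow> modulus h g \<le> ennreal d"
    using F(2) K d by (intro ballI modulus_tendsto_0) auto
  then obtain \<Delta> where \<Delta>: "\<And>g. g \<in> F \<Longrightarrow> 0 < \<Delta> g"
      "\<And>g h. g \<in> F \<Longrightarrow> 0 \<le> h \<Longrightarrow> h \<le> \<Delta> g \<Longrightarrow> modulus h g \<le> ennreal d"
    by metis
  \<comment> \<open>the element 1 keeps the set nonempty when the net is empty\<close>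
  define \<delta> where "\<delta> = Min (insert 1 (\<Delta> ` F))"
  show "\<exists>\<delta>>0. \<forall>h. 0 \<le> h \<and> h \<le> \<delta> \<longrightarrow>
     (\<forall>f\<in>K. \<forall>t\<in>{0..M}. pint (\<lambda>s. translate (t + h) f s - translate t f s) < ennreal e)"
  proof (intro exI[of _ \<delta>] conjI ballI allI impI)
    show "0 < \<delta>" using F(1) \<Delta>(1) by (simp add: \<delta>_def)
    fix h f t assume h: "0 \<le> h \<and> h \<le> \<delta>" and f: "f \<in> K"
    obtain g where g: "g \<in> F" "pint (\<lambda>x. g x - f x) < ennreal d" using F(3)[OF f] by blast
    have [measurable]: "f \<in> borel_measurable borel" "g \<in> borel_measurable borel"
      using f g F(2) K by auto
    have "\<delta> \<le> \<Delta> g" using F(1) g(1) by (simp add: \<delta>_def)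
    with h have mg: "modulus h g \<le> ennreal d" by (intro \<Delta>(2) g) auto
    have fg: "pint (\<lambda>x. f x - g x) \<le> ennreal d" using g(2) by (subst pint_minus_commute) simp
    have "pint (\<lambda>s. translate (t + h) f s - translate t f s) \<le> modulus h f"
      by (rule pint_translate_diff_le_modulus) (use f K in auto)
    also have "\<dots> \<le> ennreal c * (pint (\<lambda>x. f x - g x) + pint (\<lambda>x. f x - g x) + modulus h g)"
      unfolding c_def by (rule modulus_le_modulus_add) measurable
    also have "\<dots> \<le> ennreal c * (ennreal d + ennreal d + ennreal d)"
      using fg mg by (intro mult_left_mono add_mono) auto
    also have "\<dots> = ennreal (c * (d + d + d))"
      using c d by (simp only: ennreal_mult ennreal_plus less_imp_le add_nonneg_nonneg)
    also have "\<dots> < ennreal e"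
      using c d e by (intro ennreal_lessI) (auto simp: d_def field_simps)
    finally show "pint (\<lambda>s. translate (t + h) f s - translate t f s) < ennreal e" .
  qed
qed

lemma powr_le_imp_le:
  fixes x y :: real
  assumes "ennreal (x powr p) \<le> ennreal (y powr p)" "0 \<le> x" "0 \<le> y"
  shows "x \<le> y"
  using assms p_ge_1 by (meson ennreal_le_iff linorder_not_le powr_ge_zero powr_less_mono2 zero_less_one order_less_le_trans)

text \<open>
  The function \<open>cls\<close> records the values of \<open>average \<delta> f\<close> at the points \<open>i \<eta>\<close> of \<open>[0, R]\<close>, each rounded to an
  element of a finite net of a ball that contains all these values. Every \<open>s\<close> in \<open>[0, R]\<close> lies within \<open>\<eta>\<close>
  to the right of a grid point, which is why increments \<open>h \<ge> 0\<close> suffice.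
\<close>

lemma equi_imp_finite_classes:
  fixes K :: "(real \<Rightarrow> 'a::euclidean_space) set"
  assumes K: "\<And>f. f \<in> K \<Longrightarrow> f \<in> borel_measurable borel" "\<And>f. f \<in> K \<Longrightarrow> pint f \<le> ennreal C"
    and ec: "equi_continuous K" and d: "0 < \<delta>" and R: "0 < R" and \<kappa>: "0 < \<kappa>"
  obtains cls :: "(real \<Rightarrow> 'a) \<Rightarrow> (nat \<Rightarrow> 'a)" where "finite (cls ` K)"
    "\<And>f g s. f \<in> K \<Longrightarrow> g \<in> K \<Longrightarrow> cls f = cls g \<Longrightarrow> s \<in> {0..R} \<Longrightarrow>
      ennreal (norm (average \<delta> g s - average \<delta> f s) powr p) \<le> ennreal \<kappa>"
proof -
  define W where "W = measure \<nu> {0..\<delta>}"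
  have W: "emeasure \<nu> {0..\<delta>} = ennreal W"
    unfolding W_def using nu_finite[of \<delta>] by (intro emeasure_eq_ennreal_measure) auto
  have W0: "0 < W" using nu_pos[OF d] unfolding W by simp
  have fin: "pint f < \<infinity>" if "f \<in> K" for f
    using K(2)[OF that] by (rule order_le_less_trans) simp
  define c where "c = 3 powr p"
  have c: "0 < c" by (simp add: c_def)
  \<comment> \<open>three differences of at most \<open>e\<close>, times the constant \<open>3\<^sup>p\<close>, make up \<open>\<kappa>\<close>\<close>
  define e where "e = \<kappa> / (3 * c)"
  have e: "0 < e" using \<kappa> c by (simp add: e_def)
  obtain \<eta> where \<eta>: "0 < \<eta>" and close: "\<And>h f t. 0 \<le> h \<Longrightarrow> h \<le> \<eta> \<Longrightarrow> f \<in> K \<Longrightarrow> t \<in> {0..R} \<Longrightarrow>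
      pint (\<lambda>s. translate (t + h) f s - translate t f s) < ennreal (e * W)"
    using ec R W0 e unfolding equi_continuous_def by (metis mult_pos_pos)
  have avg_close: "ennreal (norm (average \<delta> f (t + h) - average \<delta> f t) powr p) \<le> ennreal e"
    if "f \<in> K" "0 \<le> h" "h \<le> \<eta>" "t \<in> {0..R}" for f t h
  proof -
    have "ennreal (norm (average \<delta> f (t + h) - average \<delta> f t) powr p)
        \<le> pint (\<lambda>s. translate (t + h) f s - translate t f s) / ennreal W"
      unfolding W[symmetric] by (rule norm_average_diff_powr_le[OF K(1) fin d]) (use that in auto)
    also have "\<dots> \<le> ennreal (e * W) / ennreal W"
      using close that by (intro divide_right_mono_ennreal less_imp_le) auto
    also have "\<dots> = ennreal e"
      using W0 e by (subst divide_ennreal) auto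
    finally show ?thesis .
  qed
  \<comment> \<open>a bound for all averages at all points, because translation is a contraction\<close>
  define B where "B = (max C 0 / W) powr (1 / p)"
  have avg_bounded: "norm (average \<delta> f t) \<le> B" if "f \<in> K" for f t
  proof (rule powr_le_imp_le)
    have "ennreal (norm (average \<delta> f t) powr p) \<le> pint f / ennreal W"
      unfolding W[symmetric] by (rule norm_average_powr_le[OF K(1)[OF that] d])
    also have "\<dots> \<le> ennreal (max C 0) / ennreal W"
      using K(2)[OF that] by (intro divide_right_mono_ennreal) (auto simp: max_def ennreal_neg intro: order_trans)
    also have "\<dots> = ennreal (B powr p)"
      using W0 p_ge_1 by (subst divide_ennreal) (auto simp: B_def powr_powr)
    finally show "ennreal (norm (average \<delta> f t) powr p) \<le> ennreal (B powr p)" .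
  qed (auto simp: B_def)
  \<comment> \<open>balls of radius \<open>r / 2\<close>: two values in one of them differ by less than \<open>r\<close>\<close>
  define r where "r = e powr (1 / p)"
  have r: "0 < r" "r powr p = e" using e p_ge_1 by (simp_all add: r_def powr_powr)
  obtain Z :: "'a set" where Z: "finite Z" "cball 0 B \<subseteq> (\<Union>z\<in>Z. ball z (r / 2))"
    using compact_eq_totally_bounded[of "cball (0::'a) B"] r(1) by (meson compact_cball half_gt_zero)
  define near where "near v = (SOME z. z \<in> Z \<and> v \<in> ball z (r / 2))" for v
  have near: "near v \<in> Z \<and> v \<in> ball (near v) (r / 2)" if "norm v \<le> B" for v
  proof -
    have "\<exists>z. z \<in> Z \<and> v \<in> ball z (r / 2)" using Z(2) that by (auto simp: subset_iff)
    then show ?thesis unfolding near_def by (rule someI_ex)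
  qed
  define m where "m = nat \<lfloor>R / \<eta>\<rfloor>"
  define cls where "cls f = (\<lambda>i\<in>{..m}. near (average \<delta> f (real i * \<eta>)))" for f
  show thesis
  proof
    have "cls ` K \<subseteq> PiE {..m} (\<lambda>_. Z)"
    proof (rule image_subsetI)
      fix f assume f: "f \<in> K"
      show "cls f \<in> PiE {..m} (\<lambda>_. Z)"
        unfolding cls_def restrict_PiE_iff using near[OF avg_bounded[OF f]] by blast
    qed
    then show "finite (cls ` K)"
      by (rule finite_subset) (intro finite_PiE finite_atMost Z(1))
  next
    fix f g s assume f: "f \<in> K" and g: "g \<in> K" and eq: "cls f = cls g" and s: "s \<in> {0..R}"
    define i where "i = nat \<lfloor>s / \<eta>\<rfloor>"
    have i0: "real i = of_int \<lfloor>s / \<eta>\<rfloor>" using s \<eta> by (simp add: i_def)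
    have "real i * \<eta> \<le> s" using \<eta> unfolding i0 by (metis divide_le_eq_numeral1(1) floor_divide_lower)
    moreover have "s < real i * \<eta> + \<eta>"
      using \<eta> floor_divide_upper[of \<eta> s] unfolding i0 by (simp add: algebra_simps)
    moreover have "i \<le> m"
      using s \<eta> unfolding i_def m_def by (intro nat_mono floor_mono divide_right_mono) auto
    ultimately obtain h where h: "s = real i * \<eta> + h" "0 \<le> h" "h \<le> \<eta>" and im: "i \<le> m"
      by (metis add.commute add_diff_cancel_left' diff_ge_0_iff_ge le_add_diff_inverse less_eq_real_def less_diff_eq not_le)
    let ?t = "real i * \<eta>"
    have t: "?t \<in> {0..R}" using h s \<eta> by auto
    have "near (average \<delta> f ?t) = near (average \<delta> g ?t)"
      using fun_cong[OF eq, of i] im by (simp add: cls_def)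
    then have "dist (average \<delta> g ?t) (average \<delta> f ?t) < r"
      using near[OF avg_bounded[OF f, of ?t]] near[OF avg_bounded[OF g, of ?t]]
      by (auto intro: dist_triangle_half_r)
    then have "norm (average \<delta> g ?t - average \<delta> f ?t) powr p \<le> r powr p"
      using p_ge_1 by (intro powr_mono2) (auto simp: dist_norm)
    then have mid: "ennreal (norm (average \<delta> g ?t - average \<delta> f ?t) powr p) \<le> ennreal e"
      unfolding r(2) by (rule ennreal_leI)
    let ?a = "average \<delta> g s - average \<delta> g ?t" and ?b = "average \<delta> g ?t - average \<delta> f ?t"
      and ?c = "average \<delta> f ?t - average \<delta> f s"
    have "ennreal (norm (average \<delta> g s - average \<delta> f s) powr p) = ennreal (norm (?a + ?b + ?c) powr p)"
      by simp
    also have "\<dots> \<le> ennreal c * (ennreal (norm ?a powr p) + ennreal (norm ?b powr p) + ennreal (norm ?c powr p))"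
      unfolding c_def by (rule ennreal_norm_add3_powr_le)
    also have "\<dots> \<le> ennreal c * (ennreal e + ennreal e + ennreal e)"
      using avg_close[OF f h(2,3) t] avg_close[OF g h(2,3) t] mid unfolding h(1)
      by (intro mult_left_mono add_mono) (auto simp: norm_minus_commute)
    also have "\<dots> = ennreal (c * (e + e + e))"
      using c e by (simp only: ennreal_mult ennreal_plus less_imp_le add_nonneg_nonneg)
    also have "c * (e + e + e) = \<kappa>" using c by (simp add: e_def field_simps)
    finally show "ennreal (norm (average \<delta> g s - average \<delta> f s) powr p) \<le> ennreal \<kappa>" .
  qed
qed

text \<open>
  For two functions of the same class, \<open>g - f\<close> is small on \<open>[R, \<infinity>)\<close> by equivanishing and on \<open>[0, R]\<close> since
  \<open>g - f = (g - A g) + (A g - A f) + (A f - f)\<close>. The net consists of one representative per class.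
\<close>

lemma equi_imp_totally_bounded:
  fixes K :: "(real \<Rightarrow> 'a::euclidean_space) set"
  assumes K: "\<And>f. f \<in> K \<Longrightarrow> f \<in> borel_measurable borel" "\<And>f. f \<in> K \<Longrightarrow> pint f \<le> ennreal C"
    and ev: "equi_vanishing K" and ec: "equi_continuous K"
  shows "totally_bounded K"
  unfolding totally_bounded_def
proof (intro allI impI)
  fix e :: real assume e: "0 < e"
  have fin: "pint f < \<infinity>" if "f \<in> K" for f
    using K(2)[OF that] by (rule order_le_less_trans) simp
  define c where "c = 3 powr p"
  have c: "0 < c" by (simp add: c_def)
  \<comment> \<open>the tail costs \<open>2 c d\<close> and the interval \<open>[0, R]\<close> costs \<open>3 c d\<close>, hence 6 for a strict inequality\<close>
  define d where "d = e / (6 * c)"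
  have d: "0 < d" using e c by (simp add: d_def)
  obtain R where R: "0 < R"
    and tail: "\<And>f. f \<in> K \<Longrightarrow> (\<integral>\<^sup>+x. ennreal (norm (f x) powr p) * indicator {R..} x \<partial>\<nu>) < ennreal d"
    using ev d unfolding equi_vanishing_def by blast
  obtain \<delta> where \<delta>: "0 < \<delta>" and \<delta>': "\<And>h f. 0 \<le> h \<Longrightarrow> h \<le> \<delta> \<Longrightarrow> f \<in> K \<Longrightarrow>
      pint (\<lambda>s. translate (0 + h) f s - translate 0 f s) < ennreal d"
    using ec d unfolding equi_continuous_def by (metis atLeastAtMost_iff order_refl zero_le_one zero_less_one)
  have avg: "pint (\<lambda>s. average \<delta> f s - f s) \<le> ennreal d" if f: "f \<in> K" for f
  proof (rule pint_average_diff_le[OF K(1)[OF f] fin[OF f] \<delta>])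
    fix t assume t: "t \<in> {0..\<delta>}"
    have "pint (\<lambda>s. translate t f s - f s) = pint (\<lambda>s. translate (0 + t) f s - translate 0 f s)"
      unfolding pint_def
      by (intro nn_integral_cong_AE eventually_mono[OF AE_nu]) (simp add: translate_0)
    then show "pint (\<lambda>s. translate t f s - f s) \<le> ennreal d"
      using \<delta>'[of t f] t f by simp
  qed
  define V where "V = measure \<nu> {0..R}"
  have V: "emeasure \<nu> {0..R} = ennreal V"
    unfolding V_def using nu_finite[of R] by (intro emeasure_eq_ennreal_measure) auto
  have V0: "0 < V" using nu_pos[OF R] unfolding V by simp
  obtain cls :: "(real \<Rightarrow> 'a) \<Rightarrow> (nat \<Rightarrow> 'a)" where cls: "finite (cls ` K)"
    and same: "\<And>f g s. f \<in> K \<Longrightarrow> g \<in> K \<Longrightarrow> cls f = cls g \<Longrightarrow> s \<in> {0..R} \<Longrightarrow>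
      ennreal (norm (average \<delta> g s - average \<delta> f s) powr p) \<le> ennreal (d / V)"
    using equi_imp_finite_classes[OF K ec \<delta> R, of "d / V"] d V0 by auto
  have dist: "pint (\<lambda>x. g x - f x) < ennreal e" if f: "f \<in> K" and g: "g \<in> K" and eq: "cls f = cls g" for f g
  proof -
    have [measurable]: "f \<in> borel_measurable borel" "g \<in> borel_measurable borel"
      using f g K(1) by auto
    have [measurable]: "average \<delta> f \<in> borel_measurable borel" "average \<delta> g \<in> borel_measurable borel"
      using \<delta> by (auto intro: average_measurable)
    have minus: "pint (\<lambda>x. - f x) = pint f" "(\<integral>\<^sup>+x. ennreal (norm (- f x) powr p) * indicator {R..} x \<partial>\<nu>)
        = (\<integral>\<^sup>+x. ennreal (norm (f x) powr p) * indicator {R..} x \<partial>\<nu>)"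
      by (simp_all add: pint_def)
    have far: "(\<integral>\<^sup>+x. ennreal (norm (g x - f x) powr p) * indicator {R..} x \<partial>\<nu>) \<le> ennreal (c * (d + d))"
    proof -
      have "(\<integral>\<^sup>+x. ennreal (norm (g x + (- f x)) powr p) * indicator {R..} x \<partial>\<nu>) \<le> ennreal c *
        ((\<integral>\<^sup>+x. ennreal (norm (g x) powr p) * indicator {R..} x \<partial>\<nu>) +
         (\<integral>\<^sup>+x. ennreal (norm (- f x) powr p) * indicator {R..} x \<partial>\<nu>))"
        unfolding c_def by (rule pint_tail_le) measurable
      also have "\<dots> \<le> ennreal c * (ennreal d + ennreal d)"
        unfolding minus using tail[OF f] tail[OF g] by (intro mult_left_mono add_mono) auto
      also have "\<dots> = ennreal (c * (d + d))"
        using c d by (simp only: ennreal_mult ennreal_plus less_imp_le add_nonneg_nonneg)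
      finally show ?thesis by simp
    qed
    have near: "(\<integral>\<^sup>+x. ennreal (norm (g x - f x) powr p) * indicator {0..R} x \<partial>\<nu>) \<le> ennreal (c * (d + d + d))"
    proof -
      let ?n = "\<lambda>v::'a. ennreal (norm v powr p)"
      have "(\<integral>\<^sup>+x. ?n (g x - f x) * indicator {0..R} x \<partial>\<nu>) \<le> (\<integral>\<^sup>+x. ennreal c *
          (?n (average \<delta> g x - g x) + ?n (average \<delta> f x - f x) + ennreal (d / V) * indicator {0..R} x) \<partial>\<nu>)"
      proof (rule nn_integral_mono)
        fix x
        show "?n (g x - f x) * indicator {0..R} x \<le> ennreal c *
          (?n (average \<delta> g x - g x) + ?n (average \<delta> f x - f x) + ennreal (d / V) * indicator {0..R} x)"
        proof (cases "x \<in> {0..R}")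
          case True
          let ?a = "- (average \<delta> g x - g x)" and ?b = "average \<delta> f x - f x"
            and ?c = "average \<delta> g x - average \<delta> f x"
          have "?n (g x - f x) = ?n (?a + ?b + ?c)" by simp
          also have "\<dots> \<le> ennreal c * (?n ?a + ?n ?b + ?n ?c)"
            unfolding c_def by (rule ennreal_norm_add3_powr_le)
          also have "\<dots> \<le> ennreal c * (?n (average \<delta> g x - g x) + ?n ?b + ennreal (d / V))"
            unfolding norm_minus_cancel using same[OF f g eq True]
            by (intro mult_left_mono add_mono) auto
          finally show ?thesis using True by simp
        qed simp
      qed
      also have "\<dots> = ennreal c * (pint (\<lambda>x. average \<delta> g x - g x) + pint (\<lambda>x. average \<delta> f x - f x) + ennreal (d / V) * emeasure \<nu> {0..R})"
        unfolding pint_def by (simp add: nn_integral_cmult nn_integral_add nn_integral_cmult_indicator)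
      also have "ennreal (d / V) * emeasure \<nu> {0..R} = ennreal d"
        unfolding V using V0 d by (simp flip: ennreal_mult)
      also have "ennreal c * (pint (\<lambda>x. average \<delta> g x - g x) + pint (\<lambda>x. average \<delta> f x - f x) + ennreal d)
          \<le> ennreal c * (ennreal d + ennreal d + ennreal d)"
        using avg f g by (intro mult_left_mono add_mono) auto
      also have "\<dots> = ennreal (c * (d + d + d))"
        using c d by (simp only: ennreal_mult ennreal_plus less_imp_le add_nonneg_nonneg)
      finally show ?thesis .
    qed
    have "pint (\<lambda>x. g x - f x) \<le> (\<integral>\<^sup>+x. ennreal (norm (g x - f x) powr p) * indicator {R..} x
        + ennreal (norm (g x - f x) powr p) * indicator {0..R} x \<partial>\<nu>)"
      unfolding pint_def
      by (intro nn_integral_mono_AE eventually_mono[OF AE_nu]) (auto simp: indicator_def)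
    also have "\<dots> = (\<integral>\<^sup>+x. ennreal (norm (g x - f x) powr p) * indicator {R..} x \<partial>\<nu>)
        + (\<integral>\<^sup>+x. ennreal (norm (g x - f x) powr p) * indicator {0..R} x \<partial>\<nu>)"
      by (rule nn_integral_add) measurable
    also have "\<dots> \<le> ennreal (c * (d + d)) + ennreal (c * (d + d + d))"
      using far near by (rule add_mono)
    also have "\<dots> = ennreal (c * (d + d) + c * (d + d + d))"
      using c d by (intro ennreal_plus[symmetric]) auto
    also have "\<dots> < ennreal e"
      using c e by (intro ennreal_lessI) (auto simp: d_def field_simps)
    finally show ?thesis .
  qed
  define rep where "rep = inv_into K cls"
  show "\<exists>F. finite F \<and> F \<subseteq> K \<and> (\<forall>f\<in>K. \<exists>g\<in>F. pint (\<lambda>x. g x - f x) < ennreal e)"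
  proof (intro exI[of _ "rep ` cls ` K"] conjI ballI)
    show "finite (rep ` cls ` K)" using cls by simp
    show "rep ` cls ` K \<subseteq> K" by (auto simp: rep_def intro: inv_into_into)
    fix f assume f: "f \<in> K"
    have "rep (cls f) \<in> K" "cls (rep (cls f)) = cls f"
      unfolding rep_def using f by (simp_all add: inv_into_into f_inv_into_f)
    then have "pint (\<lambda>x. rep (cls f) x - f x) < ennreal e" using f by (intro dist) auto
    then show "\<exists>g\<in>rep ` cls ` K. pint (\<lambda>x. g x - f x) < ennreal e" using f by blast
  qed
qed

theorem totally_bounded_iff:
  fixes K :: "(real \<Rightarrow> 'a::euclidean_space) set"
  assumes "\<And>f. f \<in> K \<Longrightarrow> f \<in> borel_measurable borel" "\<And>f. f \<in> K \<Longrightarrow> pint f \<le> ennreal C"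
  shows "totally_bounded K \<longleftrightarrow> equi_vanishing K \<and> equi_continuous K"
proof -
  have fin: "pint f < \<infinity>" if "f \<in> K" for f
    using assms(2)[OF that] by (rule order_le_less_trans) simp
  show ?thesis
    using totally_bounded_imp_equi_vanishing[OF assms(1) fin] totally_bounded_imp_equi_continuous[OF assms(1) fin]
      equi_imp_totally_bounded[OF assms] by blast
qed

end

section \<open>The weight and the angular law of the Bessel translation\<close>

lemma finite_nn_integral_powr:
  fixes a :: real
  assumes "-1 < a"
  shows "(\<integral>\<^sup>+y. ennreal (indicator {0<..1} y * y powr a) \<partial>lborel) < \<infinity>"
proof -
  let ?u = "\<lambda>x::real. if x \<in> {0..1} then x powr a else 0"
  have "((\<lambda>x. x powr a) has_integral (1 powr (a + 1) / (a + 1))) {0..1}"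
    using assms by (rule has_integral_powr_from_0) simp
  then have "(?u has_integral (1 powr (a + 1) / (a + 1))) UNIV"
    by (simp only: has_integral_restrict_UNIV)
  then have "(\<integral>\<^sup>+x. ennreal (?u x) \<partial>lborel) = ennreal (1 powr (a + 1) / (a + 1))"
    by (rule nn_integral_has_integral_lborel[rotated 2]) auto
  moreover have "(\<integral>\<^sup>+y. ennreal (indicator {0<..1} y * y powr a) \<partial>lborel) \<le> (\<integral>\<^sup>+x. ennreal (?u x) \<partial>lborel)"
    by (intro nn_integral_mono ennreal_leI) (auto simp: indicator_def)
  ultimately show ?thesis by (simp add: order_le_less_trans)
qed

text \<open>
  For negative \<open>\<alpha>\<close> the integrand has poles at both ends. Polar coordinates reduce the claim to
  \<open>\<integral>\<^sub>0\<^sup>1 y\<^sup>2\<^sup>\<alpha> dy < \<infinity>\<close>: the integral of \<open>y\<^sup>2\<^sup>\<alpha>\<close> over the half of the unit disc in the upper half plane is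
  the product of \<open>\<integral>\<^sub>0\<^sup>1 s\<^sup>2\<^sup>\<alpha>\<^sup>+\<^sup>1 ds > 0\<close> with the integral in question, and this half disc lies in a box.
\<close>

lemma nn_integral_sin_powr_finite:
  assumes "- 1 / 2 < \<alpha>"
  shows "(\<integral>\<^sup>+t. indicator {0<..<pi} t * ennreal (sin t powr (2 * \<alpha>)) \<partial>lborel) < \<infinity>" (is "?J < \<infinity>")
proof -
  define F :: "real \<times> real \<Rightarrow> ennreal" where
    "F = (\<lambda>(x, y). indicator {-1..1} x * ennreal (indicator {0<..1} y * y powr (2 * \<alpha>)))"
  have [measurable]: "F \<in> borel_measurable borel"
    unfolding F_def borel_prod[symmetric] by measurable
  let ?A = "\<integral>\<^sup>+s. ennreal (indicator {0<..1} s * s powr (2 * \<alpha> + 1)) \<partial>lborel"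
  have le: "ennreal (indicator {0<..1} s * s powr (2 * \<alpha> + 1)) * ?J \<le>
      ennreal (indicator {0<..} s * s) * (\<integral>\<^sup>+t. indicator {0<..<pi} t * F (s * cos t, s * sin t) \<partial>lborel)" for s
  proof (cases "s \<in> {0<..1}")
    case True
    have "ennreal (s powr (2 * \<alpha> + 1)) * ?J = ennreal s * (\<integral>\<^sup>+t. ennreal (s powr (2 * \<alpha>)) * (indicator {0<..<pi} t * ennreal (sin t powr (2 * \<alpha>))) \<partial>lborel)"
      using True by (subst nn_integral_cmult) (auto simp: powr_add ennreal_mult mult_ac)
    also have "\<dots> \<le> ennreal s * (\<integral>\<^sup>+t. indicator {0<..<pi} t * F (s * cos t, s * sin t) \<partial>lborel)"
    proof (intro mult_left_mono nn_integral_mono)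
      fix t :: real
      show "ennreal (s powr (2 * \<alpha>)) * (indicator {0<..<pi} t * ennreal (sin t powr (2 * \<alpha>)))
          \<le> indicator {0<..<pi} t * F (s * cos t, s * sin t)"
      proof (cases "t \<in> {0<..<pi}")
        case t: True
        then have "0 < sin t" by (intro sin_gt_zero) auto
        moreover have "\<bar>s * cos t\<bar> \<le> 1" "\<bar>s * sin t\<bar> \<le> 1"
          using True mult_mono[of "\<bar>s\<bar>" 1 "\<bar>cos t\<bar>" 1] mult_mono[of "\<bar>s\<bar>" 1 "\<bar>sin t\<bar>" 1] by (simp_all add: abs_mult)
        ultimately have "F (s * cos t, s * sin t) = ennreal ((s * sin t) powr (2 * \<alpha>))"
          using True by (auto simp: F_def abs_le_iff indicator_def)
        also have "\<dots> = ennreal (s powr (2 * \<alpha>)) * ennreal (sin t powr (2 * \<alpha>))"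
          using True \<open>0 < sin t\<close> by (simp add: powr_mult ennreal_mult)
        finally show ?thesis using t by simp
      qed simp
    qed simp
    finally show ?thesis using True by simp
  qed simp
  have "?A * ?J = (\<integral>\<^sup>+s. ennreal (indicator {0<..1} s * s powr (2 * \<alpha> + 1)) * ?J \<partial>lborel)"
    by (rule nn_integral_multc[symmetric]) measurable
  also have "\<dots> \<le> (\<integral>\<^sup>+s. ennreal (indicator {0<..} s * s) *
         (\<integral>\<^sup>+t. indicator {0<..<pi} t * F (s * cos t, s * sin t) \<partial>lborel) \<partial>lborel)"
    by (intro nn_integral_mono le)
  also have "\<dots> = (\<integral>\<^sup>+y. indicator {0<..} y * (\<integral>\<^sup>+x. F (x, y) \<partial>lborel) \<partial>lborel)"
    by (rule nn_integral_polar_upper_half_plane[symmetric]) measurable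
  also have "\<dots> = (\<integral>\<^sup>+y. 2 * ennreal (indicator {0<..1} y * y powr (2 * \<alpha>)) \<partial>lborel)"
    by (intro nn_integral_cong) (simp add: F_def nn_integral_multc, simp add: indicator_def)
  also have "\<dots> = 2 * (\<integral>\<^sup>+y. ennreal (indicator {0<..1} y * y powr (2 * \<alpha>)) \<partial>lborel)"
    by (rule nn_integral_cmult) measurable
  also have "\<dots> < \<infinity>"
    using finite_nn_integral_powr[of "2 * \<alpha>"] assms by (simp add: ennreal_mult_less_top)
  finally have "?A * ?J < \<infinity>" .
  moreover have "?A \<noteq> 0"
  proof
    assume "?A = 0"
    then have "AE s in lborel. s \<notin> {0<..1::real}"
      by (subst (asm) nn_integral_0_iff_AE) (auto elim!: eventually_mono simp: indicator_def split: if_splits)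
    then have "emeasure lborel {0<..1::real} = 0"
      by (subst (asm) AE_iff_measurable[of "{0<..1}"]) auto
    then show False by simp
  qed
  ultimately show ?thesis
    by (auto simp: ennreal_mult_less_top)
qed

text \<open>
  The normalising constant is defined by a Bochner integral over the closed interval. The end points
  contribute 0, since \<open>0 powr x = 0\<close>, and finiteness identifies it with the integral over the open interval.
\<close>

lemma bessel_const_pos:
  assumes "- 1 / 2 < \<alpha>"
  shows "0 < bessel_const \<alpha>"
    and "ennreal (bessel_const \<alpha>) * (\<integral>\<^sup>+t. indicator {0<..<pi} t * ennreal (sin t powr (2 * \<alpha>)) \<partial>lborel) = 1"
proof -
  let ?J = "\<integral>\<^sup>+t. indicator {0<..<pi} t * ennreal (sin t powr (2 * \<alpha>)) \<partial>lborel"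
  have "?J \<noteq> 0"
  proof
    assume "?J = 0"
    then have "AE s in lborel. s \<notin> {0<..<pi}"
      by (subst (asm) nn_integral_0_iff_AE)
        (auto elim!: eventually_mono simp: indicator_def dest: sin_gt_zero split: if_splits)
    then have "emeasure lborel {0<..<pi} = 0"
      by (subst (asm) AE_iff_measurable[of "{0<..<pi}"]) auto
    then show False by simp
  qed
  with nn_integral_sin_powr_finite[OF assms] obtain j where j: "?J = ennreal j" "0 < j"
    by (cases ?J) (auto simp: less_le)
  have "(LINT \<phi>:{0..pi}|lebesgue. sin \<phi> powr (2 * \<alpha>)) = (LINT \<phi>|lborel. indicator {0..pi} \<phi> *\<^sub>R sin \<phi> powr (2 * \<alpha>))"
    unfolding set_lebesgue_integral_def by (rule integral_completion) measurable
  also have "\<dots> = enn2real (\<integral>\<^sup>+\<phi>. ennreal (indicator {0..pi} \<phi> *\<^sub>R sin \<phi> powr (2 * \<alpha>)) \<partial>lborel)"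
    by (rule integral_eq_nn_integral) auto
  also have "(\<integral>\<^sup>+\<phi>. ennreal (indicator {0..pi} \<phi> *\<^sub>R sin \<phi> powr (2 * \<alpha>)) \<partial>lborel) = ?J"
  proof (rule nn_integral_cong)
    fix \<phi> :: real
    have "\<phi> = 0 \<or> \<phi> = pi" if "\<phi> \<in> {0..pi}" "\<phi> \<notin> {0<..<pi}" using that by auto
    then show "ennreal (indicator {0..pi} \<phi> *\<^sub>R sin \<phi> powr (2 * \<alpha>)) = indicator {0<..<pi} \<phi> * ennreal (sin \<phi> powr (2 * \<alpha>))"
      by (cases "\<phi> \<in> {0<..<pi}"; cases "\<phi> \<in> {0..pi}") auto
  qed
  finally have "bessel_const \<alpha> = inverse j"
    using j by (simp add: bessel_const_def)
  with j show "0 < bessel_const \<alpha>" "ennreal (bessel_const \<alpha>) * ?J = 1"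
    by (simp_all flip: ennreal_mult)
qed

definition radial_measure :: "real \<Rightarrow> real measure" where
  "radial_measure \<alpha> = density lborel (\<lambda>x. ennreal (indicator {0..} x * x powr (2 * \<alpha> + 1)))"

text \<open>
  The law of \<open>cos \<phi>\<close> under the probability measure \<open>\<mu>\<close> of the Bessel translation; in the limiting case,
  the two point masses at the angles 0 and \<open>\<pi>\<close> have cosines 1 and -1.
\<close>

definition cos_law :: "real \<Rightarrow> real measure" where
  "cos_law \<alpha> = (if \<alpha> = - 1 / 2 then distr (uniform_count_measure {-1, 1}) borel (\<lambda>w. w)
     else distr (density lborel (\<lambda>\<phi>. ennreal (indicator {0<..<pi} \<phi> * (bessel_const \<alpha> * sin \<phi> powr (2 * \<alpha>))))) borel cos)"

lemma sets_radial_measure [measurable_cong, simp]: "sets (radial_measure \<alpha>) = sets borel"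
  by (simp add: radial_measure_def)

lemma sets_cos_law [measurable_cong, simp]: "sets (cos_law \<alpha>) = sets borel"
  by (simp add: cos_law_def)

lemma nn_integral_radial_measure:
  assumes [measurable]: "g \<in> borel_measurable borel"
  shows "(\<integral>\<^sup>+s. g s \<partial>radial_measure \<alpha>) = (\<integral>\<^sup>+s. ennreal (indicator {0..} s * s powr (2 * \<alpha> + 1)) * g s \<partial>lborel)"
  unfolding radial_measure_def by (rule nn_integral_density) measurable

lemma measurable_uniform_count_measure_id:
  "(\<lambda>w. w) \<in> uniform_count_measure {-1, 1::real} \<rightarrow>\<^sub>M borel"
  by (simp add: measurable_def space_uniform_count_measure sets_uniform_count_measure)

lemma nn_integral_cos_law_half:
  assumes g: "g \<in> borel_measurable borel"
  shows "(\<integral>\<^sup>+w. g w \<partial>cos_law (- 1 / 2)) = (g (- 1) + g 1) / 2"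
proof -
  have half: "ennreal (1 / 2) = inverse 2"
    by (metis divide_ennreal_def ennreal_1 ennreal_divide_numeral mult_1 zero_le_one)
  have "(\<integral>\<^sup>+w. g w \<partial>cos_law (- 1 / 2)) = (\<integral>\<^sup>+w. g w \<partial>uniform_count_measure {-1, 1})"
    unfolding cos_law_def using g measurable_uniform_count_measure_id by (simp add: nn_integral_distr)
  also have "\<dots> = (\<Sum>w\<in>{-1, 1}. ennreal (1 / 2) * g w)"
    unfolding uniform_count_measure_def by (subst nn_integral_point_measure_finite) simp_all
  also have "\<dots> = (g (- 1) + g 1) / 2"
    by (simp only: half) (simp add: divide_ennreal_def distrib_left mult.commute)
  finally show ?thesis .
qed

lemma integral_cos_law_half:
  fixes g :: "real \<Rightarrow> 'a::{banach, second_countable_topology}"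
  assumes g: "g \<in> borel_measurable borel"
  shows "(\<integral>w. g w \<partial>cos_law (- 1 / 2)) = (1 / 2) *\<^sub>R (g (- 1) + g 1)"
proof -
  have "(\<integral>w. g w \<partial>cos_law (- 1 / 2)) = (\<integral>w. g w \<partial>uniform_count_measure {-1, 1})"
    unfolding cos_law_def using g measurable_uniform_count_measure_id by (simp add: integral_distr)
  also have "\<dots> = (\<Sum>w\<in>{-1, 1}. (1 / 2) *\<^sub>R g w)"
    unfolding uniform_count_measure_def by (subst lebesgue_integral_point_measure_finite) simp_all
  finally show ?thesis by (simp add: scaleR_add_right)
qed

lemma nn_integral_cos_law:
  assumes [measurable]: "g \<in> borel_measurable borel" and \<alpha>: "- 1 / 2 < \<alpha>"
  shows "(\<integral>\<^sup>+w. g w \<partial>cos_law \<alpha>) = (\<integral>\<^sup>+\<phi>. ennreal (indicator {0<..<pi} \<phi> * (bessel_const \<alpha> * sin \<phi> powr (2 * \<alpha>))) * g (cos \<phi>) \<partial>lborel)"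
  using \<alpha> by (simp add: cos_law_def nn_integral_distr nn_integral_density)

text \<open>
  Polar coordinates applied to \<open>y\<^sup>2\<^sup>\<alpha> F (x, y)\<close>: with \<open>y = s sin \<phi>\<close>, the weight splits as
  \<open>s\<^sup>2\<^sup>\<alpha>\<^sup>+\<^sup>1 sin\<^sup>2\<^sup>\<alpha> \<phi>\<close>, one power of \<open>s\<close> being the Jacobian.
\<close>

lemma nn_integral_radial_cos_law:
  fixes F :: "real \<times> real \<Rightarrow> ennreal"
  assumes [measurable]: "F \<in> borel_measurable borel" and \<alpha>: "- 1 / 2 < \<alpha>"
  shows "(\<integral>\<^sup>+s. \<integral>\<^sup>+w. F (s * w, s * sqrt (1 - w\<^sup>2)) \<partial>cos_law \<alpha> \<partial>radial_measure \<alpha>) =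
    ennreal (bessel_const \<alpha>) * (\<integral>\<^sup>+y. indicator {0<..} y * (\<integral>\<^sup>+x. ennreal (y powr (2 * \<alpha>)) * F (x, y) \<partial>lborel) \<partial>lborel)"
proof -
  have [measurable]: "F \<in> borel_measurable (borel \<Otimes>\<^sub>M borel)" by (simp add: borel_prod)
  define c where "c = bessel_const \<alpha>"
  have c: "0 < c" using bessel_const_pos(1)[OF \<alpha>] by (simp add: c_def)
  define G where "G = (\<lambda>(x, y). ennreal (y powr (2 * \<alpha>)) * F (x, y))"
  have [measurable]: "G \<in> borel_measurable borel"
    unfolding G_def borel_prod[symmetric] by measurable
  have pointwise: "ennreal (indicator {0..} s * s powr (2 * \<alpha> + 1)) * (ennreal (indicator {0<..<pi} t * (c * sin t powr (2 * \<alpha>))) * F (s * cos t, s * sqrt (1 - (cos t)\<^sup>2)))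
      = ennreal c * (ennreal (indicator {0<..} s * s) * (indicator {0<..<pi} t * G (s * cos t, s * sin t)))" for s t
  proof (cases "0 < s \<and> t \<in> {0<..<pi}")
    case True
    then have sin: "0 < sin t" by (intro sin_gt_zero) auto
    then have sq: "sqrt (1 - (cos t)\<^sup>2) = sin t" by (simp add: sin_squared_eq[symmetric])
    have "s powr (2 * \<alpha> + 1) * (c * sin t powr (2 * \<alpha>)) = c * (s * (s * sin t) powr (2 * \<alpha>))"
      using True sin by (simp add: powr_add powr_mult)
    then have "ennreal (s powr (2 * \<alpha> + 1)) * ennreal (c * sin t powr (2 * \<alpha>)) = ennreal c * (ennreal s * ennreal ((s * sin t) powr (2 * \<alpha>)))"
      using True c by (simp flip: ennreal_mult)
    then show ?thesis
      using True by (simp add: G_def sq) (simp only: mult.assoc[symmetric])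
  next
    case False
    then show ?thesis by (cases "s = 0") (auto simp: indicator_def)
  qed
  have "(\<integral>\<^sup>+s. \<integral>\<^sup>+w. F (s * w, s * sqrt (1 - w\<^sup>2)) \<partial>cos_law \<alpha> \<partial>radial_measure \<alpha>)
      = (\<integral>\<^sup>+s. ennreal (indicator {0..} s * s powr (2 * \<alpha> + 1)) *
          (\<integral>\<^sup>+t. ennreal (indicator {0<..<pi} t * (c * sin t powr (2 * \<alpha>))) * F (s * cos t, s * sqrt (1 - (cos t)\<^sup>2)) \<partial>lborel) \<partial>lborel)"
    by (simp add: nn_integral_cos_law[OF _ \<alpha>] nn_integral_radial_measure c_def)
  also have "\<dots> = (\<integral>\<^sup>+s. ennreal c * (ennreal (indicator {0<..} s * s) * (\<integral>\<^sup>+t. indicator {0<..<pi} t * G (s * cos t, s * sin t) \<partial>lborel)) \<partial>lborel)"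
  proof (rule nn_integral_cong)
    fix s :: real
    have "ennreal (indicator {0..} s * s powr (2 * \<alpha> + 1)) *
        (\<integral>\<^sup>+t. ennreal (indicator {0<..<pi} t * (c * sin t powr (2 * \<alpha>))) * F (s * cos t, s * sqrt (1 - (cos t)\<^sup>2)) \<partial>lborel)
      = (\<integral>\<^sup>+t. ennreal (indicator {0..} s * s powr (2 * \<alpha> + 1)) *
        (ennreal (indicator {0<..<pi} t * (c * sin t powr (2 * \<alpha>))) * F (s * cos t, s * sqrt (1 - (cos t)\<^sup>2))) \<partial>lborel)"
      by (rule nn_integral_cmult[symmetric]) measurable
    also have "\<dots> = (\<integral>\<^sup>+t. ennreal c * (ennreal (indicator {0<..} s * s) * (indicator {0<..<pi} t * G (s * cos t, s * sin t))) \<partial>lborel)"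
      unfolding pointwise ..
    also have "\<dots> = ennreal c * (ennreal (indicator {0<..} s * s) * (\<integral>\<^sup>+t. indicator {0<..<pi} t * G (s * cos t, s * sin t) \<partial>lborel))"
      by (simp add: nn_integral_cmult)
    finally show "ennreal (indicator {0..} s * s powr (2 * \<alpha> + 1)) *
        (\<integral>\<^sup>+t. ennreal (indicator {0<..<pi} t * (c * sin t powr (2 * \<alpha>))) * F (s * cos t, s * sqrt (1 - (cos t)\<^sup>2)) \<partial>lborel)
      = ennreal c * (ennreal (indicator {0<..} s * s) * (\<integral>\<^sup>+t. indicator {0<..<pi} t * G (s * cos t, s * sin t) \<partial>lborel))" .
  qed
  also have "\<dots> = ennreal c * (\<integral>\<^sup>+s. ennreal (indicator {0<..} s * s) * (\<integral>\<^sup>+t. indicator {0<..<pi} t * G (s * cos t, s * sin t) \<partial>lborel) \<partial>lborel)"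
    by (rule nn_integral_cmult) measurable
  also have "\<dots> = ennreal c * (\<integral>\<^sup>+y. indicator {0<..} y * (\<integral>\<^sup>+x. G (x, y) \<partial>lborel) \<partial>lborel)"
    by (subst nn_integral_polar_upper_half_plane) simp_all
  finally show ?thesis by (simp add: G_def c_def)
qed

text \<open>
  The density \<open>y\<^sup>2\<^sup>\<alpha>\<close> does not involve \<open>x\<close>, so for each \<open>y\<close> the substitution \<open>x \<mapsto> t - x\<close> removes \<open>t\<close>.
\<close>

lemma radial_cos_law_shift_invariant:
  fixes F :: "real \<times> real \<Rightarrow> ennreal"
  assumes [measurable]: "F \<in> borel_measurable borel" and \<alpha>: "- 1 / 2 < \<alpha>"
  shows "(\<integral>\<^sup>+s. \<integral>\<^sup>+w. F (t - s * w, s * sqrt (1 - w\<^sup>2)) \<partial>cos_law \<alpha> \<partial>radial_measure \<alpha>) =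
    ennreal (bessel_const \<alpha>) * (\<integral>\<^sup>+y. indicator {0<..} y * (\<integral>\<^sup>+x. ennreal (y powr (2 * \<alpha>)) * F (x, y) \<partial>lborel) \<partial>lborel)"
proof -
  have [measurable]: "F \<in> borel_measurable (borel \<Otimes>\<^sub>M borel)" by (simp add: borel_prod)
  define G where "G = (\<lambda>(x, y). F (t - x, y))"
  have G: "G \<in> borel_measurable borel"
    unfolding G_def borel_prod[symmetric] by measurable
  have "(\<integral>\<^sup>+x. ennreal (y powr (2 * \<alpha>)) * F (t - x, y) \<partial>lborel) = (\<integral>\<^sup>+x. ennreal (y powr (2 * \<alpha>)) * F (x, y) \<partial>lborel)" for y
    using nn_integral_real_affine[of "\<lambda>x. ennreal (y powr (2 * \<alpha>)) * F (x, y)" "-1" t] by simp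
  then show ?thesis
    using nn_integral_radial_cos_law[OF G \<alpha>] by (simp add: G_def)
qed

text \<open>
  Here the two half lines \<open>t + s\<close> and \<open>t - s\<close> together make up the whole line \<open>y = 0\<close>.
\<close>

lemma radial_cos_law_shift_invariant_half:
  fixes F :: "real \<times> real \<Rightarrow> ennreal"
  assumes [measurable]: "F \<in> borel_measurable borel"
  shows "(\<integral>\<^sup>+s. \<integral>\<^sup>+w. F (t - s * w, s * sqrt (1 - w\<^sup>2)) \<partial>cos_law (- 1 / 2) \<partial>radial_measure (- 1 / 2)) =
    (\<integral>\<^sup>+x. F (x, 0) \<partial>lborel) / 2"
proof -
  have [measurable]: "F \<in> borel_measurable (borel \<Otimes>\<^sub>M borel)" by (simp add: borel_prod)
  have "(\<integral>\<^sup>+s. \<integral>\<^sup>+w. F (t - s * w, s * sqrt (1 - w\<^sup>2)) \<partial>cos_law (- 1 / 2) \<partial>radial_measure (- 1 / 2))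
      = (\<integral>\<^sup>+s. indicator {0<..} s * ((F (t + s, 0) + F (t - s, 0)) / 2) \<partial>lborel)"
  proof -
    have "(\<integral>\<^sup>+w. F (t - s * w, s * sqrt (1 - w\<^sup>2)) \<partial>cos_law (- 1 / 2)) = (F (t + s, 0) + F (t - s, 0)) / 2" for s
      by (subst nn_integral_cos_law_half) simp_all
    moreover have "(\<integral>\<^sup>+s. (F (t + s, 0) + F (t - s, 0)) / 2 \<partial>radial_measure (- 1 / 2))
        = (\<integral>\<^sup>+s. ennreal (indicator {0..} s * s powr (2 * (- 1 / 2) + 1)) * ((F (t + s, 0) + F (t - s, 0)) / 2) \<partial>lborel)"
      by (rule nn_integral_radial_measure) measurable
    moreover have "ennreal (indicator {0..} s * s powr (2 * (- 1 / 2) + 1)) = indicator {0<..} s" for s :: real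
      by (auto simp: indicator_def)
    ultimately show ?thesis by simp
  qed
  also have "\<dots> = (\<integral>\<^sup>+s. (indicator {0<..} s * F (t + s, 0) + indicator {0<..} s * F (t - s, 0)) / 2 \<partial>lborel)"
    by (intro nn_integral_cong) (auto simp: indicator_def)
  also have "\<dots> = ((\<integral>\<^sup>+s. indicator {0<..} s * F (t + s, 0) \<partial>lborel) + (\<integral>\<^sup>+s. indicator {0<..} s * F (t - s, 0) \<partial>lborel)) / 2"
    by (simp add: nn_integral_divide nn_integral_add)
  also have "(\<integral>\<^sup>+s. indicator {0<..} s * F (t - s, 0) \<partial>lborel) = (\<integral>\<^sup>+s. indicator {..<0} s * F (t + s, 0) \<partial>lborel)"
  proof -
    have "indicator {0<..} (- s) = (indicator {..<0} s :: ennreal)" for s :: real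
      by (simp add: indicator_def)
    then show ?thesis
      using nn_integral_real_affine[of "\<lambda>s. indicator {0<..} s * F (t - s, 0)" "-1" 0] by simp
  qed
  also have "(\<integral>\<^sup>+s. indicator {0<..} s * F (t + s, 0) \<partial>lborel) + (\<integral>\<^sup>+s. indicator {..<0} s * F (t + s, 0) \<partial>lborel)
      = (\<integral>\<^sup>+s. indicator {0<..} s * F (t + s, 0) + indicator {..<0} s * F (t + s, 0) \<partial>lborel)"
    by (rule nn_integral_add[symmetric]) measurable
  also have "\<dots> = (\<integral>\<^sup>+s. F (t + s, 0) \<partial>lborel)"
    by (intro nn_integral_cong_AE eventually_mono[OF AE_lborel_singleton[of 0]]) (auto simp: indicator_def)
  also have "\<dots> = (\<integral>\<^sup>+x. F (x, 0) \<partial>lborel)"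
    using nn_integral_real_affine[of "\<lambda>x. F (x, 0)" 1 t] by simp
  finally show ?thesis .
qed

lemma AE_radial_measure_iff:
  "(AE s in radial_measure \<alpha>. P s) \<longleftrightarrow> (AE s in lborel. 0 \<le> s \<longrightarrow> P s)"
proof -
  have "(AE s in radial_measure \<alpha>. P s) \<longleftrightarrow> (AE s in lborel. 0 < ennreal (indicator {0..} s * s powr (2 * \<alpha> + 1)) \<longrightarrow> P s)"
    unfolding radial_measure_def by (rule AE_density) measurable
  also have "\<dots> \<longleftrightarrow> (AE s in lborel. 0 \<le> s \<longrightarrow> P s)"
  proof -
    have "AE s in lborel. s \<noteq> (0::real)" by (rule AE_lborel_singleton)
    then have "AE s in lborel. (0 < ennreal (indicator {0..} s * s powr (2 * \<alpha> + 1)) \<longrightarrow> P s) \<longleftrightarrow> (0 \<le> s \<longrightarrow> P s)"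
      by eventually_elim (auto simp: indicator_def)
    then show ?thesis by (rule eventually_subst)
  qed
  finally show ?thesis .
qed

lemma sigma_finite_radial_measure: "sigma_finite_measure (radial_measure \<alpha>)"
  unfolding radial_measure_def
  by (subst sigma_finite_measure.sigma_finite_iff_density_finite[OF lborel.sigma_finite_measure_axioms]) auto

lemma AE_cos_law_half:
  assumes [measurable]: "Measurable.pred borel P"
  shows "(AE w in cos_law (- 1 / 2). P w) \<longleftrightarrow> P (- 1) \<and> P 1"
proof -
  have "(AE w in cos_law (- 1 / 2). P w) \<longleftrightarrow> (AE w in cos_law (- 1 / 2). indicator {w. \<not> P w} w = (0::ennreal))"
    by (simp add: indicator_def)
  also have "\<dots> \<longleftrightarrow> (\<integral>\<^sup>+w. indicator {w. \<not> P w} w \<partial>cos_law (- 1 / 2)) = 0"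
    by (rule nn_integral_0_iff_AE[symmetric]) measurable
  also have "(\<integral>\<^sup>+w. indicator {w. \<not> P w} w \<partial>cos_law (- 1 / 2)) =
      (indicator {w. \<not> P w} (- 1) + indicator {w. \<not> P w} 1) / (2::ennreal)"
    by (rule nn_integral_cos_law_half) measurable
  also have "\<dots> = 0 \<longleftrightarrow> P (- 1) \<and> P 1"
    by (auto simp: indicator_def ennreal_divide_eq_0_iff)
  finally show ?thesis .
qed

lemma radial_translation_bessel:
  assumes \<alpha>: "- 1 / 2 \<le> \<alpha>" and p: "1 \<le> p"
  shows "radial_translation (cos_law \<alpha>) (radial_measure \<alpha>) p"
proof -
  interpret nu: sigma_finite_measure "radial_measure \<alpha>" by (rule sigma_finite_radial_measure)
  have prob: "prob_space (cos_law \<alpha>)"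
  proof (rule prob_spaceI)
    show "emeasure (cos_law \<alpha>) (space (cos_law \<alpha>)) = 1"
    proof (cases "\<alpha> = - 1 / 2")
      case True
      have "emeasure (cos_law (- 1 / 2)) UNIV = (\<integral>\<^sup>+w. 1 \<partial>cos_law (- 1 / 2))"
        by (simp add: cos_law_def)
      also have "\<dots> = 1" by (subst nn_integral_cos_law_half) simp_all
      finally show ?thesis using True by (simp add: cos_law_def)
    next
      case False
      with \<alpha> have \<alpha>': "- 1 / 2 < \<alpha>" by simp
      have "emeasure (cos_law \<alpha>) (space (cos_law \<alpha>)) = (\<integral>\<^sup>+w. 1 \<partial>cos_law \<alpha>)" by simp
      also have "\<dots> = (\<integral>\<^sup>+t. ennreal (bessel_const \<alpha>) * (indicator {0<..<pi} t * ennreal (sin t powr (2 * \<alpha>))) \<partial>lborel)"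
        using bessel_const_pos(1)[OF \<alpha>'] \<alpha>'
        by (subst nn_integral_cos_law) (auto intro!: nn_integral_cong simp: ennreal_mult indicator_def)
      also have "\<dots> = 1"
        using bessel_const_pos(2)[OF \<alpha>'] by (subst nn_integral_cmult) auto
      finally show ?thesis .
    qed
  qed
  interpret mu: prob_space "cos_law \<alpha>" by (rule prob)
  show ?thesis
  proof (unfold_locales)
    show "AE w in cos_law \<alpha>. w \<in> {-1..1}"
    proof (cases "\<alpha> = - 1 / 2")
      case True
      show ?thesis unfolding True using AE_cos_law_half[of "\<lambda>w. w \<in> {-1..1}"] by simp
    next
      case False
      show ?thesis
        unfolding cos_law_def if_not_P[OF False] by (subst AE_distr_iff) auto
    qed
    show "AE s in radial_measure \<alpha>. 0 \<le> s"
      by (simp add: AE_radial_measure_iff)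
    show "(AE s in radial_measure \<alpha>. P s)" if "AE s in lborel. P s" for P
      unfolding AE_radial_measure_iff using that by (rule eventually_mono) simp
    have density: "emeasure (radial_measure \<alpha>) {0..R} = (\<integral>\<^sup>+s. ennreal (indicator {0..} s * s powr (2 * \<alpha> + 1)) * indicator {0..R} s \<partial>lborel)" for R
      unfolding radial_measure_def by (rule emeasure_density) auto
    show "emeasure (radial_measure \<alpha>) {0..R} < \<infinity>" for R
    proof -
      have "emeasure (radial_measure \<alpha>) {0..R} \<le> (\<integral>\<^sup>+s. ennreal (R powr (2 * \<alpha> + 1)) * indicator {0..R} s \<partial>lborel)"
        unfolding density
      proof (rule nn_integral_mono)
        fix s :: real
        show "ennreal (indicator {0..} s * s powr (2 * \<alpha> + 1)) * indicator {0..R} s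
            \<le> ennreal (R powr (2 * \<alpha> + 1)) * indicator {0..R} s"
        proof (cases "s \<in> {0..R}")
          case True
          then have "s powr (2 * \<alpha> + 1) \<le> R powr (2 * \<alpha> + 1)"
            using \<alpha> by (intro powr_mono2) auto
          then show ?thesis using True by (simp add: ennreal_leI)
        qed simp
      qed
      also have "\<dots> = ennreal (R powr (2 * \<alpha> + 1)) * emeasure lborel {0..R}"
        by (rule nn_integral_cmult_indicator) simp
      also have "\<dots> < \<infinity>" by (simp add: ennreal_mult_less_top emeasure_lborel_Icc_eq)
      finally show ?thesis .
    qed
    show "0 < emeasure (radial_measure \<alpha>) {0..\<delta>}" if "0 < \<delta>" for \<delta>
    proof (rule ccontr)
      assume "\<not> ?thesis"
      then have "emeasure (radial_measure \<alpha>) {0..\<delta>} = 0" by simp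
      then have "AE s in radial_measure \<alpha>. s \<notin> {0..\<delta>}"
        by (intro AE_not_in null_setsI) auto
      then have "AE s in lborel. s \<notin> {0..\<delta>}"
        unfolding AE_radial_measure_iff by eventually_elim auto
      then have "emeasure lborel {0..\<delta>} = 0"
        by (subst (asm) AE_iff_measurable[of "{0..\<delta>}"]) auto
      with that show False by simp
    qed
    show "(\<integral>\<^sup>+s. \<integral>\<^sup>+w. F (t - s * w, s * sqrt (1 - w\<^sup>2)) \<partial>cos_law \<alpha> \<partial>radial_measure \<alpha>) =
      (\<integral>\<^sup>+s. \<integral>\<^sup>+w. F (- (s * w), s * sqrt (1 - w\<^sup>2)) \<partial>cos_law \<alpha> \<partial>radial_measure \<alpha>)"
      if F: "F \<in> borel_measurable borel" for F :: "real \<times> real \<Rightarrow> ennreal" and t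
    proof (cases "\<alpha> = - 1 / 2")
      case True
      show ?thesis
        using radial_cos_law_shift_invariant_half[OF F, of t] radial_cos_law_shift_invariant_half[OF F, of 0]
        unfolding True by simp
    next
      case False
      with \<alpha> have \<alpha>': "- 1 / 2 < \<alpha>" by simp
      show ?thesis
        using radial_cos_law_shift_invariant[OF F \<alpha>', of t] radial_cos_law_shift_invariant[OF F \<alpha>', of 0]
        by simp
    qed
  qed (simp_all add: p)
qed

section \<open>From Lebesgue measurable to Borel functions\<close>

lemma eLp_norm_less_iff:
  assumes p: "1 \<le> p" and e: "0 < \<epsilon>"
  shows "eLp_norm p M f < ennreal \<epsilon> \<longleftrightarrow> (\<integral>\<^sup>+x. ennreal (norm (f x) powr p) \<partial>M) < ennreal (\<epsilon> powr p)"
proof (cases "\<integral>\<^sup>+x. ennreal (norm (f x) powr p) \<partial>M")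
  case (real r)
  have "r powr (1 / p) < \<epsilon> \<longleftrightarrow> r < \<epsilon> powr p"
  proof
    assume "r powr (1 / p) < \<epsilon>"
    then have "(r powr (1 / p)) powr p < \<epsilon> powr p" using p by (intro powr_less_mono2) auto
    then show "r < \<epsilon> powr p" using p real by (simp add: powr_powr)
  next
    assume "r < \<epsilon> powr p"
    then have "r powr (1 / p) < (\<epsilon> powr p) powr (1 / p)" using p real by (intro powr_less_mono2) auto
    then show "r powr (1 / p) < \<epsilon>" using p e by (simp add: powr_powr)
  qed
  then show ?thesis
    using real e by (simp add: eLp_norm_def Let_def ennreal_less_iff)
next
  case top
  then show ?thesis by (simp add: eLp_norm_def Let_def)
qed

text \<open>
  It lets a condition on norms be stated for their \<open>p\<close>-th powers.
\<close>

lemma all_pos_powr_iff: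
  assumes "0 < (p::real)"
  shows "(\<forall>\<epsilon>>0. P (\<epsilon> powr p)) \<longleftrightarrow> (\<forall>\<epsilon>>0. P \<epsilon>)"
proof safe
  fix \<epsilon> :: real assume all: "\<forall>\<epsilon>>0. P (\<epsilon> powr p)" and \<epsilon>: "0 < \<epsilon>"
  then have "P ((\<epsilon> powr (1 / p)) powr p)" by simp
  then show "P \<epsilon>" using assms \<epsilon> by (simp add: powr_powr)
qed simp

text \<open>
  Exchanges the weighted measure on Lebesgue sets for the one on Borel sets, provided the integrand is
  almost everywhere Borel.
\<close>

lemma nn_integral_bessel_measure:
  assumes [measurable]: "g \<in> borel_measurable borel" and eq: "AE x in radial_measure \<alpha>. f x = g x"
  shows "(\<integral>\<^sup>+x. f x \<partial>bessel_measure \<alpha>) = (\<integral>\<^sup>+x. g x \<partial>radial_measure \<alpha>)"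
proof -
  have meas [measurable]: "h \<in> borel_measurable (lebesgue_on {0..})" if "h \<in> borel_measurable borel" for h :: "real \<Rightarrow> ennreal"
    using that by (intro measurable_restrict_space1 measurable_completion) simp
  have w: "(\<lambda>x. ennreal (x powr (2 * \<alpha> + 1))) \<in> borel_measurable (lebesgue_on {0..})" by (rule meas) measurable
  have "AE x in lebesgue. 0 \<le> x \<longrightarrow> f x = g x"
    using eq unfolding AE_radial_measure_iff by (rule AE_completion)
  then have "AE x in lebesgue_on {0..}. f x = g x"
    by (subst AE_restrict_space_iff) auto
  then have "AE x in bessel_measure \<alpha>. f x = g x"
    unfolding bessel_measure_def by (subst AE_density[OF w]) (erule eventually_mono, simp)
  then have "(\<integral>\<^sup>+x. f x \<partial>bessel_measure \<alpha>) = (\<integral>\<^sup>+x. g x \<partial>bessel_measure \<alpha>)"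
    by (rule nn_integral_cong_AE)
  also have "\<dots> = (\<integral>\<^sup>+x. ennreal (x powr (2 * \<alpha> + 1)) * g x \<partial>lebesgue_on {0..})"
    unfolding bessel_measure_def using w by (intro nn_integral_density) simp_all
  also have "\<dots> = (\<integral>\<^sup>+x. ennreal (x powr (2 * \<alpha> + 1)) * g x * indicator {0..} x \<partial>lebesgue)"
    by (rule nn_integral_restrict_space) simp
  also have "\<dots> = (\<integral>\<^sup>+x. ennreal (indicator {0..} x * x powr (2 * \<alpha> + 1)) * g x \<partial>lborel)"
    unfolding nn_integral_completion by (intro nn_integral_cong) (simp add: indicator_def)
  also have "\<dots> = (\<integral>\<^sup>+x. g x \<partial>radial_measure \<alpha>)"
    by (rule nn_integral_radial_measure[symmetric]) measurable
  finally show ?thesis .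
qed

lemma nn_integral_restrict_bessel_measure:
  "(\<integral>\<^sup>+x. f x \<partial>restrict_space (bessel_measure \<alpha>) {R..}) = (\<integral>\<^sup>+x. f x * indicator {R..} x \<partial>bessel_measure \<alpha>)"
proof (rule nn_integral_restrict_space)
  have "{R..} \<inter> {0..} = {max R 0..}" by auto
  then show "{R..} \<inter> space (bessel_measure \<alpha>) \<in> sets (bessel_measure \<alpha>)"
    by (simp add: bessel_measure_def sets_restrict_space_iff)
qed

text \<open>
  Almost everywhere, \<open>f\<close> is a limit of continuous functions, and the limit of a sequence of Borel functions is Borel.
\<close>

lemma Lp_ex_borel:
  fixes f :: "real \<Rightarrow> 'a::euclidean_space"
  assumes "f \<in> borel_measurable (bessel_measure \<alpha>)"
  obtains g where "g \<in> borel_measurable borel" "AE x in lborel. 0 \<le> x \<longrightarrow> f x = g x"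
proof -
  have "f \<in> borel_measurable (lebesgue_on {0..})"
    using assms by (simp add: bessel_measure_def)
  then have "f measurable_on {0..}" by (simp add: measurable_on_iff_borel_measurable)
  then obtain N k where N: "negligible N" and k: "\<And>n. continuous_on UNIV (k n)"
    and lim: "\<And>x. x \<notin> N \<Longrightarrow> (\<lambda>n. k n x) \<longlonglongrightarrow> (if x \<in> {0..} then f x else 0)"
    unfolding measurable_on_def by auto
  define g where "g x = lim (\<lambda>n. k n x)" for x
  have [measurable]: "k n \<in> borel_measurable borel" for n
    using k by (rule borel_measurable_continuous_onI)
  have "g \<in> borel_measurable borel" unfolding g_def by (rule borel_measurable_lim_metric) simp
  moreover have "AE x in lborel. x \<notin> N"
    using N by (metis AE_completion_iff AE_not_in negligible_iff_null_sets)
  then have "AE x in lborel. 0 \<le> x \<longrightarrow> f x = g x"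
  proof eventually_elim
    case (elim x)
    then show ?case using limI[OF lim[OF elim]] by (simp add: g_def)
  qed
  ultimately show thesis by (rule that)
qed

text \<open>
  Let \<open>N\<close> be a Borel null set outside which \<open>f\<close> and \<open>g\<close> agree. By \<open>AE_rad\<close>, for almost every \<open>s\<close> only a
  null set of points on the half circle of radius \<open>s\<close> around \<open>(t, 0)\<close> has its distance from the origin in
  \<open>N\<close>. So the integrands of both translations agree almost everywhere, and completeness of Lebesgue
  measure makes the first one measurable.
\<close>

lemma bessel_translation_eq_translate:
  fixes \<alpha> p :: real and f g :: "real \<Rightarrow> 'a::euclidean_space"
  assumes \<alpha>: "- 1 / 2 \<le> \<alpha>" and p: "1 \<le> p" and [measurable]: "g \<in> borel_measurable borel"
    and fg: "AE x in lborel. 0 \<le> x \<longrightarrow> f x = g x" and t: "0 \<le> t"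
  shows "AE s in radial_measure \<alpha>. bessel_translation \<alpha> t f s = radial_translation.translate (cos_law \<alpha>) t g s"
proof -
  interpret radial_translation "cos_law \<alpha>" "radial_measure \<alpha>" p
    by (rule radial_translation_bessel[OF \<alpha> p])
  obtain N where N: "N \<in> null_sets lborel" "\<And>x. x \<notin> N \<Longrightarrow> 0 \<le> x \<Longrightarrow> f x = g x"
    using fg by (auto elim!: AE_E3)
  have [measurable]: "N \<in> sets borel" using N(1) by auto
  have "AE x in radial_measure \<alpha>. x \<notin> N"
    by (intro AE_nu_if_AE_lborel AE_not_in N)
  then have "AE s in radial_measure \<alpha>. AE w in cos_law \<alpha>. rad t s w \<notin> N"
    by (rule AE_rad) measurable
  then show ?thesis
    using AE_nu
  proof eventually_elim
    case (elim s)
    have translate_eq: "translate t g s = (\<integral>w. g (rad t s w) \<partial>cos_law \<alpha>)" by (rule translate_def)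
    show ?case
    proof (cases "\<alpha> = - 1 / 2")
      case True
      have "AE w in cos_law (- 1 / 2). rad t s w \<notin> N" using elim(1) unfolding True .
      then have "rad t s (- 1) \<notin> N" "rad t s 1 \<notin> N"
        by (simp_all add: AE_cos_law_half)
      moreover have "rad t s (- 1) = s + t" "rad t s 1 = \<bar>s - t\<bar>"
        using t elim(2) by (simp_all add: rad_eq_norm norm_Pair abs_minus_commute add.commute)
      moreover have "translate t g s = (1 / 2) *\<^sub>R (g (rad t s (- 1)) + g (rad t s 1))"
        unfolding translate_eq unfolding True by (rule integral_cos_law_half) measurable
      ultimately show ?thesis
        using True N(2) t elim(2) by (simp add: bessel_translation_def)
    next
      case False
      with \<alpha> have \<alpha>': "- 1 / 2 < \<alpha>" by simp
      define c where "c = bessel_const \<alpha>"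
      have c: "0 < c" using bessel_const_pos(1)[OF \<alpha>'] by (simp add: c_def)
      let ?w = "\<lambda>\<phi>. indicator {0<..<pi} \<phi> * (c * sin \<phi> powr (2 * \<alpha>))"
      let ?h = "\<lambda>u \<phi>. indicator {0..pi} \<phi> *\<^sub>R ((c * sin \<phi> powr (2 * \<alpha>)) *\<^sub>R (u (sqrt (t\<^sup>2 + s\<^sup>2 - 2 * s * t * cos \<phi>)) :: 'a))"
      have "AE \<phi> in lborel. 0 < ennreal (?w \<phi>) \<longrightarrow> rad t s (cos \<phi>) \<notin> N"
        using elim(1) unfolding cos_law_def if_not_P[OF False] c_def[symmetric]
        by (subst (asm) AE_distr_iff; (subst (asm) AE_density)?; measurable?; simp)
      then have "AE \<phi> in lborel. ?h g \<phi> = ?h f \<phi>"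
      proof eventually_elim
        case (elim \<phi>)
        show ?case
        proof (cases "\<phi> \<in> {0<..<pi}")
          case True
          then have "0 < sin \<phi>" by (intro sin_gt_zero) auto
          then have "rad t s (cos \<phi>) \<notin> N" using elim True c by simp
          moreover have "0 \<le> rad t s (cos \<phi>)" by (subst rad_eq_norm) auto
          ultimately have "f (rad t s (cos \<phi>)) = g (rad t s (cos \<phi>))" using N(2) by simp
          then show ?thesis by (simp add: rad_def)
        next
          case False
          then have "\<phi> = 0 \<or> \<phi> = pi \<or> \<phi> \<notin> {0..pi}" by auto
          then show ?thesis by auto
        qed
      qed
      then have eq: "AE \<phi> in lebesgue. ?h g \<phi> = ?h f \<phi>" by (rule AE_completion)
      have meas: "?h g \<in> borel_measurable lborel" by measurable
      have "bessel_translation \<alpha> t f s = integral\<^sup>L lebesgue (?h f)"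
        using False by (simp add: bessel_translation_def set_lebesgue_integral_def c_def)
      also have "\<dots> = integral\<^sup>L lebesgue (?h g)"
        using eq by (intro integral_cong_AE borel_measurable_AE[OF measurable_completion[OF meas] eq]
            measurable_completion[OF meas]) auto
      also have "\<dots> = integral\<^sup>L lborel (?h g)"
        using meas by (rule integral_completion)
      also have "\<dots> = (\<integral>\<phi>. ?w \<phi> *\<^sub>R g (rad t s (cos \<phi>)) \<partial>lborel)"
      proof (rule Bochner_Integration.integral_cong[OF refl])
        fix \<phi> :: real
        have "\<phi> = 0 \<or> \<phi> = pi" if "\<phi> \<in> {0..pi}" "\<phi> \<notin> {0<..<pi}" using that by auto
        then show "?h g \<phi> = ?w \<phi> *\<^sub>R g (rad t s (cos \<phi>))"
          by (cases "\<phi> \<in> {0<..<pi}"; cases "\<phi> \<in> {0..pi}") (auto simp: rad_def)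
      qed
      also have "\<dots> = (\<integral>\<phi>. g (rad t s (cos \<phi>)) \<partial>density lborel (\<lambda>\<phi>. ennreal (?w \<phi>)))"
        using c by (intro integral_density[symmetric]) auto
      also have "\<dots> = translate t g s"
        unfolding translate_eq unfolding cos_law_def if_not_P[OF False] c_def[symmetric]
        by (subst integral_distr) auto
      finally show ?thesis .
    qed
  qed
qed

theorem theorem3:
  fixes \<alpha> p :: real
    and K :: "(real \<Rightarrow> 'a::{real_normed_field, euclidean_space}) set"
  assumes "\<alpha> \<ge> - 1 / 2"
    and "1 \<le> p"
    and "K \<subseteq> Lp p \<alpha>"
    and "Lp_bounded p \<alpha> K"
  shows "Lp_totally_bounded p \<alpha> K \<longleftrightarrow> equivanishing p \<alpha> K \<and> Lp_equicontinuous p \<alpha> K"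
proof -
  interpret radial_translation "cos_law \<alpha>" "radial_measure \<alpha>" p
    by (rule radial_translation_bessel) fact+
  have p0: "0 < p" using assms(2) by simp
  have "\<forall>f\<in>K. \<exists>g. g \<in> borel_measurable borel \<and> (AE x in lborel. 0 \<le> x \<longrightarrow> f x = g x)"
    using assms(3) by (auto simp: Lp_def elim: Lp_ex_borel)
  then obtain B where B_meas: "\<And>f. f \<in> K \<Longrightarrow> B f \<in> borel_measurable borel"
    and B_lborel: "\<And>f. f \<in> K \<Longrightarrow> AE x in lborel. 0 \<le> x \<longrightarrow> f x = B f x"
    by metis
  have B_eq: "AE x in radial_measure \<alpha>. f x = B f x" if "f \<in> K" for f
    using B_lborel[OF that] by (simp add: AE_radial_measure_iff)
  have pint_B: "(\<integral>\<^sup>+x. ennreal (norm (f x) powr p) \<partial>bessel_measure \<alpha>) = pint (B f)" if "f \<in> K" for f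
    unfolding pint_def
  proof (rule nn_integral_bessel_measure)
    show "AE x in radial_measure \<alpha>. ennreal (norm (f x) powr p) = ennreal (norm (B f x) powr p)"
      using B_eq[OF that] by eventually_elim simp
  qed (use B_meas[OF that] in measurable)
  have pint_diff: "(\<integral>\<^sup>+x. ennreal (norm (g x - f x) powr p) \<partial>bessel_measure \<alpha>) = pint (\<lambda>x. B g x - B f x)"
    if "f \<in> K" "g \<in> K" for f g
    unfolding pint_def
  proof (rule nn_integral_bessel_measure)
    show "AE x in radial_measure \<alpha>. ennreal (norm (g x - f x) powr p) = ennreal (norm (B g x - B f x) powr p)"
      using B_eq[OF that(1)] B_eq[OF that(2)] by eventually_elim simp
  qed (use B_meas[OF that(1)] B_meas[OF that(2)] in measurable)
  have pint_tail: "(\<integral>\<^sup>+x. ennreal (norm (f x) powr p) \<partial>restrict_space (bessel_measure \<alpha>) {R..})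
      = (\<integral>\<^sup>+x. ennreal (norm (B f x) powr p) * indicator {R..} x \<partial>radial_measure \<alpha>)" if "f \<in> K" for f R
    unfolding nn_integral_restrict_bessel_measure
  proof (rule nn_integral_bessel_measure)
    show "AE x in radial_measure \<alpha>. ennreal (norm (f x) powr p) * indicator {R..} x = ennreal (norm (B f x) powr p) * indicator {R..} x"
      using B_eq[OF that] by eventually_elim simp
  qed (use B_meas[OF that] in measurable)
  have pint_translate: "(\<integral>\<^sup>+s. ennreal (norm (bessel_translation \<alpha> (t + h) f s - bessel_translation \<alpha> t f s) powr p) \<partial>bessel_measure \<alpha>)
      = pint (\<lambda>s. translate (t + h) (B f) s - translate t (B f) s)" if "f \<in> K" "0 \<le> t" "0 \<le> h" for f t h
    unfolding pint_def
  proof (rule nn_integral_bessel_measure)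
    have "AE s in radial_measure \<alpha>. bessel_translation \<alpha> u f s = translate u (B f) s" if "0 \<le> u" for u
      by (rule bessel_translation_eq_translate[OF assms(1,2) B_meas B_lborel that]) fact+
    then have "AE s in radial_measure \<alpha>. bessel_translation \<alpha> (t + h) f s = translate (t + h) (B f) s"
      and "AE s in radial_measure \<alpha>. bessel_translation \<alpha> t f s = translate t (B f) s"
      using that by simp_all
    then show "AE s in radial_measure \<alpha>. ennreal (norm (bessel_translation \<alpha> (t + h) f s - bessel_translation \<alpha> t f s) powr p)
      = ennreal (norm (translate (t + h) (B f) s - translate t (B f) s) powr p)"
      by eventually_elim simp
  qed (use B_meas[OF that(1)] in measurable)
  obtain C where C: "\<And>f. f \<in> K \<Longrightarrow> eLp_norm p (bessel_measure \<alpha>) f \<le> ennreal C"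
    using assms(4) unfolding Lp_bounded_def by blast
  have bounded: "pint (B f) \<le> ennreal ((\<bar>C\<bar> + 1) powr p)" if "f \<in> K" for f
  proof -
    have "eLp_norm p (bessel_measure \<alpha>) f < ennreal (\<bar>C\<bar> + 1)"
      using C[OF that] by (rule order_le_less_trans) (rule ennreal_lessI; linarith)
    then show ?thesis
      by (subst (asm) eLp_norm_less_iff[OF assms(2)]) (auto simp: pint_B[OF that])
  qed
  have tb: "Lp_totally_bounded p \<alpha> K \<longleftrightarrow> totally_bounded (B ` K)"
  proof -
    have "Lp_totally_bounded p \<alpha> K \<longleftrightarrow> (\<forall>\<epsilon>>0. \<exists>F. finite F \<and> F \<subseteq> K \<and>
        (\<forall>f\<in>K. \<exists>g\<in>F. pint (\<lambda>x. B g x - B f x) < ennreal (\<epsilon> powr p)))"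
      unfolding Lp_totally_bounded_def
      by (intro all_cong1 imp_cong refl ex_cong1 conj_cong ball_cong bex_cong)
        (simp add: eLp_norm_less_iff[OF assms(2)] pint_diff subset_iff)
    also have "\<dots> \<longleftrightarrow> (\<forall>\<epsilon>>0. \<exists>F. finite F \<and> F \<subseteq> K \<and>
        (\<forall>f\<in>K. \<exists>g\<in>F. pint (\<lambda>x. B g x - B f x) < ennreal \<epsilon>))"
      by (rule all_pos_powr_iff[OF p0])
    also have "\<dots> \<longleftrightarrow> totally_bounded (B ` K)"
    proof -
      have "(\<exists>F. finite F \<and> F \<subseteq> K \<and> (\<forall>f\<in>K. \<exists>g\<in>F. pint (\<lambda>x. B g x - B f x) < ennreal \<epsilon>)) \<longleftrightarrow>
        (\<exists>F. finite F \<and> F \<subseteq> B ` K \<and> (\<forall>f\<in>B ` K. \<exists>g\<in>F. pint (\<lambda>x. g x - f x) < ennreal \<epsilon>))" for \<epsilon>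
        by (simp add: ex_finite_subset_image)
      then show ?thesis unfolding totally_bounded_def by presburger
    qed
    finally show ?thesis .
  qed
  have ev: "equivanishing p \<alpha> K \<longleftrightarrow> equi_vanishing (B ` K)"
  proof -
    have "equivanishing p \<alpha> K \<longleftrightarrow> (\<forall>\<epsilon>>0. \<exists>R>0. \<forall>f\<in>K.
        (\<integral>\<^sup>+x. ennreal (norm (B f x) powr p) * indicator {R..} x \<partial>radial_measure \<alpha>) < ennreal (\<epsilon> powr p))"
      unfolding equivanishing_def
      by (intro all_cong1 imp_cong refl ex_cong1 conj_cong ball_cong)
        (simp add: eLp_norm_less_iff[OF assms(2)] pint_tail)
    also have "\<dots> \<longleftrightarrow> (\<forall>\<epsilon>>0. \<exists>R>0. \<forall>f\<in>K.
        (\<integral>\<^sup>+x. ennreal (norm (B f x) powr p) * indicator {R..} x \<partial>radial_measure \<alpha>) < ennreal \<epsilon>)"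
      by (rule all_pos_powr_iff[OF p0])
    finally show ?thesis by (simp add: equi_vanishing_def)
  qed
  have ec: "Lp_equicontinuous p \<alpha> K \<longleftrightarrow> equi_continuous (B ` K)"
  proof -
    have "Lp_equicontinuous p \<alpha> K \<longleftrightarrow> (\<forall>\<epsilon>>0. \<forall>M>0. \<exists>\<delta>>0. \<forall>h. 0 \<le> h \<and> h \<le> \<delta> \<longrightarrow>
        (\<forall>f\<in>K. \<forall>t\<in>{0..M}. pint (\<lambda>s. translate (t + h) (B f) s - translate t (B f) s) < ennreal (\<epsilon> powr p)))"
      unfolding Lp_equicontinuous_def
      by (intro all_cong1 imp_cong refl ex_cong1 conj_cong ball_cong)
        (simp add: eLp_norm_less_iff[OF assms(2)] pint_translate)
    also have "\<dots> \<longleftrightarrow> (\<forall>\<epsilon>>0. \<forall>M>0. \<exists>\<delta>>0. \<forall>h. 0 \<le> h \<and> h \<le> \<delta> \<longrightarrow>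
        (\<forall>f\<in>K. \<forall>t\<in>{0..M}. pint (\<lambda>s. translate (t + h) (B f) s - translate t (B f) s) < ennreal \<epsilon>))"
      by (rule all_pos_powr_iff[OF p0])
    finally show ?thesis by (simp add: equi_continuous_def)
  qed
  have "totally_bounded (B ` K) \<longleftrightarrow> equi_vanishing (B ` K) \<and> equi_continuous (B ` K)"
    by (rule totally_bounded_iff[where C = "(\<bar>C\<bar> + 1) powr p"]) (use B_meas bounded in auto)
  then show ?thesis unfolding tb ev ec .
qed

end
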